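(* Let $a,e$ be integers with $1\le a\le e-1$. There exists an (even commutative) short local algebra $A$ of Hilbert type $(e,a)$ with a reflexive module of Loewy length $2$ with dimension vector $(1,a)$.
   Context: Let $k$ be an arbitrary fixed field. All algebras $A$ are finite-dimensional local $k$-algebras with radical $J$ such that $A/J=k$. $A$ is short if $J^3=0$. $|M|$ denotes the length of a module $M$. The Hilbert type of a short local algebra $A$ is $(|J/J^2|,|J^2|)$. Modules are left $A$-modules of finite length. If $M$ has Loewy length at most $2$, its dimension vector is $(|M/JM|,|JM|)$. With $M^*=\operatorname{Hom}_A(M,{}_AA)$, the module $M$ is reflexive if the canonical map $M\to M^{**}$, $m\mapsto(\alpha\mapsto\alpha(m))$, is bijective. *)

theory Defs
  imports "HOL-Algebra.QuotRing" "HOL-Algebra.Ideal_Product" "HOL-Algebra.Module"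
begin

text \<open>The locale \<^locale>\<open>module\<close> of the library requires a commutative ring of scalars. Here
  scalars are elements of an arbitrary ring, and modules are left modules. As in the library, the
  fields \<open>mult\<close> and \<open>one\<close> of the record of a module carry no meaning.\<close>

locale left_module = A: ring A + M: abelian_group M
  for A :: "('a, 'm) ring_scheme" (structure) and M :: "('a, 'b, 'n) module_scheme" (structure) +
  assumes smult_closed:
      "\<lbrakk>a \<in> carrier A; x \<in> carrier M\<rbrakk> \<Longrightarrow> a \<odot>\<^bsub>M\<^esub> x \<in> carrier M"
    and smult_l_distr:
      "\<lbrakk>a \<in> carrier A; b \<in> carrier A; x \<in> carrier M\<rbrakk> \<Longrightarrow>
        (a \<oplus>\<^bsub>A\<^esub> b) \<odot>\<^bsub>M\<^esub> x = a \<odot>\<^bsub>M\<^esub> x \<oplus>\<^bsub>M\<^esub> b \<odot>\<^bsub>M\<^esub> x"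
    and smult_r_distr:
      "\<lbrakk>a \<in> carrier A; x \<in> carrier M; y \<in> carrier M\<rbrakk> \<Longrightarrow>
        a \<odot>\<^bsub>M\<^esub> (x \<oplus>\<^bsub>M\<^esub> y) = a \<odot>\<^bsub>M\<^esub> x \<oplus>\<^bsub>M\<^esub> a \<odot>\<^bsub>M\<^esub> y"
    and smult_assoc:
      "\<lbrakk>a \<in> carrier A; b \<in> carrier A; x \<in> carrier M\<rbrakk> \<Longrightarrow>
        (a \<otimes>\<^bsub>A\<^esub> b) \<odot>\<^bsub>M\<^esub> x = a \<odot>\<^bsub>M\<^esub> (b \<odot>\<^bsub>M\<^esub> x)"
    and smult_one: "x \<in> carrier M \<Longrightarrow> \<one>\<^bsub>A\<^esub> \<odot>\<^bsub>M\<^esub> x = x"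

definition regular_module :: "('a, 'm) ring_scheme \<Rightarrow> ('a, 'a) module" where
  "regular_module A = \<lparr>carrier = carrier A, mult = mult A, one = one A, zero = zero A,
     add = add A, smult = mult A\<rparr>"

definition quotient_module :: "('a, 'b, 'm) module_scheme \<Rightarrow> 'b set \<Rightarrow> ('a, 'b set) module" where
  "quotient_module M N = \<lparr>carrier = a_rcosets\<^bsub>M\<^esub> N, mult = undefined, one = undefined, zero = N,
     add = set_add M, smult = (\<lambda>a X. \<Union>x\<in>X. N +>\<^bsub>M\<^esub> (a \<odot>\<^bsub>M\<^esub> x))\<rparr>"

text \<open>\<open>has_length A M n\<close>: the module \<open>M\<close> has a composition series with \<open>n\<close> simple factors.\<close>

definition has_length ::
    "('a, 'm) ring_scheme \<Rightarrow> ('a, 'b, 'n) module_scheme \<Rightarrow> nat \<Rightarrow> bool" where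
  "has_length A M n \<longleftrightarrow> (\<exists>C. C 0 = {\<zero>\<^bsub>M\<^esub>} \<and> C n = carrier M \<and>
     (\<forall>i\<le>n. submodule (C i) A M) \<and>
     (\<forall>i<n. C i \<subset> C (Suc i) \<and> \<not> (\<exists>N. submodule N A M \<and> C i \<subset> N \<and> N \<subset> C (Suc i))))"

definition finite_length_module ::
    "('a, 'm) ring_scheme \<Rightarrow> ('a, 'b, 'n) module_scheme \<Rightarrow> bool" where
  "finite_length_module A M \<longleftrightarrow> left_module A M \<and> (\<exists>n. has_length A M n)"

text \<open>The submodule \<open>I U\<close> of \<open>M\<close>, that is, all finite sums of products \<open>a u\<close>; compare
  \<^const>\<open>ideal_prod\<close>.\<close>

inductive_set smult_prod ::
    "('a, 'b, 'n) module_scheme \<Rightarrow> 'a set \<Rightarrow> 'b set \<Rightarrow> 'b set" for M and I and U where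
  prod: "\<lbrakk>a \<in> I; u \<in> U\<rbrakk> \<Longrightarrow> a \<odot>\<^bsub>M\<^esub> u \<in> smult_prod M I U"
| sum: "\<lbrakk>x \<in> smult_prod M I U; y \<in> smult_prod M I U\<rbrakk> \<Longrightarrow> x \<oplus>\<^bsub>M\<^esub> y \<in> smult_prod M I U"

definition maximal_left_ideal :: "'a set \<Rightarrow> ('a, 'm) ring_scheme \<Rightarrow> bool" where
  "maximal_left_ideal L A \<longleftrightarrow> submodule L A (regular_module A) \<and> L \<noteq> carrier A \<and>
     (\<forall>N. submodule N A (regular_module A) \<and> L \<subseteq> N \<longrightarrow> N = L \<or> N = carrier A)"

definition radical :: "('a, 'm) ring_scheme \<Rightarrow> 'a set" where
  "radical A = carrier A \<inter> \<Inter> {L. maximal_left_ideal L A}"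

definition local_ring :: "('a, 'm) ring_scheme \<Rightarrow> bool" where
  "local_ring A \<longleftrightarrow> (\<exists>!L. maximal_left_ideal L A)"

locale fd_algebra = K: field K + A: ring A + module K A
  for K :: "('k, 'm) ring_scheme" (structure) and A :: "('k, 'a, 'n) module_scheme" (structure) +
  assumes smult_mult_left:
      "\<lbrakk>c \<in> carrier K; x \<in> carrier A; y \<in> carrier A\<rbrakk> \<Longrightarrow>
        (c \<odot>\<^bsub>A\<^esub> x) \<otimes>\<^bsub>A\<^esub> y = c \<odot>\<^bsub>A\<^esub> (x \<otimes>\<^bsub>A\<^esub> y)"
    and smult_mult_right:
      "\<lbrakk>c \<in> carrier K; x \<in> carrier A; y \<in> carrier A\<rbrakk> \<Longrightarrow>
        x \<otimes>\<^bsub>A\<^esub> (c \<odot>\<^bsub>A\<^esub> y) = c \<odot>\<^bsub>A\<^esub> (x \<otimes>\<^bsub>A\<^esub> y)"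
    and finite_dimensional:
      "\<exists>B. finite B \<and> B \<subseteq> carrier A \<and>
        (\<forall>x\<in>carrier A. \<exists>c\<in>B \<rightarrow> carrier K. x = (\<Oplus>\<^bsub>A\<^esub>b\<in>B. c b \<odot>\<^bsub>A\<^esub> b))"

text \<open>The condition \<open>A/J = k\<close> means that the structure map from \<open>k\<close> to \<open>A/J\<close> is an isomorphism.\<close>

definition local_algebra ::
    "('k, 'm) ring_scheme \<Rightarrow> ('k, 'a, 'n) module_scheme \<Rightarrow> bool" where
  "local_algebra K A \<longleftrightarrow> fd_algebra K A \<and> local_ring A \<and>
     (\<lambda>c. radical A +>\<^bsub>A\<^esub> (c \<odot>\<^bsub>A\<^esub> \<one>\<^bsub>A\<^esub>)) \<in> ring_iso K (A Quot radical A)"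

definition short_local_algebra ::
    "('k, 'm) ring_scheme \<Rightarrow> ('k, 'a, 'n) module_scheme \<Rightarrow> bool" where
  "short_local_algebra K A \<longleftrightarrow> local_algebra K A \<and>
     (radical A \<cdot>\<^bsub>A\<^esub> radical A) \<cdot>\<^bsub>A\<^esub> radical A = {\<zero>\<^bsub>A\<^esub>}"

definition hilbert_type :: "('a, 'm) ring_scheme \<Rightarrow> nat \<Rightarrow> nat \<Rightarrow> bool" where
  "hilbert_type A e a \<longleftrightarrow>
     (let J = radical A; J2 = J \<cdot>\<^bsub>A\<^esub> J; R = regular_module A in
       has_length A (quotient_module (R\<lparr>carrier := J\<rparr>) J2) e \<and>
       has_length A (R\<lparr>carrier := J2\<rparr>) a)"

definition loewy_length ::
    "('a, 'm) ring_scheme \<Rightarrow> ('a, 'b, 'n) module_scheme \<Rightarrow> nat \<Rightarrow> bool" where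
  "loewy_length A M n \<longleftrightarrow>
     (smult_prod M (radical A) ^^ n) (carrier M) = {\<zero>\<^bsub>M\<^esub>} \<and>
     (\<forall>i<n. (smult_prod M (radical A) ^^ i) (carrier M) \<noteq> {\<zero>\<^bsub>M\<^esub>})"

definition dimension_vector ::
    "('a, 'm) ring_scheme \<Rightarrow> ('a, 'b, 'n) module_scheme \<Rightarrow> nat \<Rightarrow> nat \<Rightarrow> bool" where
  "dimension_vector A M t s \<longleftrightarrow>
     (let JM = smult_prod M (radical A) (carrier M) in
       has_length A (quotient_module M JM) t \<and> has_length A (M\<lparr>carrier := JM\<rparr>) s)"

definition linear_maps ::
    "('a, 'm) ring_scheme \<Rightarrow> ('a, 'b, 'n) module_scheme \<Rightarrow> ('a, 'c, 'p) module_scheme \<Rightarrow>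
      ('b \<Rightarrow> 'c) set" where
  "linear_maps A M N = {f \<in> carrier M \<rightarrow>\<^sub>E carrier N.
     (\<forall>x\<in>carrier M. \<forall>y\<in>carrier M. f (x \<oplus>\<^bsub>M\<^esub> y) = f x \<oplus>\<^bsub>N\<^esub> f y) \<and>
     (\<forall>a\<in>carrier A. \<forall>x\<in>carrier M. f (a \<odot>\<^bsub>M\<^esub> x) = a \<odot>\<^bsub>N\<^esub> f x)}"

text \<open>Right \<open>A\<close>-modules are treated as left modules over the opposite ring. In particular the dual
  of a left \<open>A\<close>-module, a right module under \<open>(f a)(x) = f(x) a\<close>, is a left module over
  \<open>opposite A\<close>; and the dual of a right \<open>A\<close>-module \<open>N\<close> is \<open>dual (opposite A) N\<close>, a left \<open>A\<close>-module
  under \<open>(a \<phi>)(f) = a \<phi>(f)\<close>, because \<open>opposite (opposite A) = A\<close>.\<close>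

definition opposite :: "('a, 'm) ring_scheme \<Rightarrow> ('a, 'm) ring_scheme" where
  "opposite A = A\<lparr>mult := (\<lambda>x y. y \<otimes>\<^bsub>A\<^esub> x)\<rparr>"

definition dual ::
    "('a, 'm) ring_scheme \<Rightarrow> ('a, 'b, 'n) module_scheme \<Rightarrow> ('a, 'b \<Rightarrow> 'a) module" where
  "dual A M = \<lparr>carrier = linear_maps A M (regular_module A), mult = undefined, one = undefined,
     zero = (\<lambda>x\<in>carrier M. \<zero>\<^bsub>A\<^esub>), add = (\<lambda>f g. \<lambda>x\<in>carrier M. f x \<oplus>\<^bsub>A\<^esub> g x),
     smult = (\<lambda>a f. \<lambda>x\<in>carrier M. f x \<otimes>\<^bsub>A\<^esub> a)\<rparr>"

definition reflexive_module ::
    "('a, 'm) ring_scheme \<Rightarrow> ('a, 'b, 'n) module_scheme \<Rightarrow> bool" where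
  "reflexive_module A M \<longleftrightarrow>
     bij_betw (\<lambda>m. \<lambda>\<alpha>\<in>carrier (dual A M). \<alpha> m)
       (carrier M) (carrier (dual (opposite A) (dual A M)))"

end

theory Submission
  imports Defs
begin

text \<open>Let \<open>J = V \<oplus> W\<close> where \<open>V\<close> has a basis \<open>x, y\<^sub>1, ..., y\<^sub>a, z\<^sub>1, ..., z\<^sub>b\<close> with \<open>b = e - 1 - a\<close> and \<open>W\<close> has a
basis \<open>w\<^sub>1, ..., w\<^sub>a\<close>. On \<open>A = k \<oplus> J\<close> a commutative multiplication is defined by \<open>x y\<^sub>i = w\<^sub>i\<close> and
\<open>z\<^sub>j\<^sup>2 = w\<^sub>1\<close>, all other products of basis vectors of \<open>J\<close> being zero. Products of three elements of \<open>J\<close>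
vanish, so \<open>A\<close> is associative, local with radical \<open>J\<close> and short, and \<open>J\<^sup>2 = W\<close>; its Hilbert type is
\<open>(e, a)\<close>. The module is the ideal \<open>M = Ax\<close>, which is spanned by \<open>x\<close> and \<open>W = Jx = J\<^sup>2\<close>. As \<open>JM = W\<close> is
nonzero and \<open>JW = 0\<close>, it has Loewy length \<open>2\<close> and dimension vector \<open>(1, a)\<close>.

Reflexivity follows from the equation \<open>ann (ann x) = Ax\<close>: an ideal \<open>Ax\<close> of a commutative ring with this
property is reflexive, because its dual is then generated by the inclusion of \<open>Ax\<close> into \<open>A\<close>, which has
the same annihilator as \<open>x\<close> (lemma \<open>reflexive_principal_ideal\<close>). The equation holds here because the
annihilator of \<open>x\<close> contains \<open>x\<close>, which detects \<open>1\<close> and the \<open>y\<^sub>i\<close>, and the \<open>z\<^sub>j\<close>, each of which detects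
itself (lemma \<open>x_double_annihilator\<close>). The products \<open>z\<^sub>j\<^sup>2\<close> are there for this purpose only.

The construction gives a short local algebra for every symmetric bilinear map from \<open>V \<times> V\<close> to \<open>W\<close>
(locale \<open>bilinear_local_algebra\<close>). All lengths are those of ideals spanned by
coordinate vectors, or of quotients of such ideals; they are counted by filtrations that add one
coordinate at a time (lemmas \<open>coord_space_composition_chain\<close> and \<open>has_length_quotient_module\<close>).\<close>

section \<open>Quotients of modules and composition series\<close>

lemma (in module) left_module: "left_module R M"
  by (intro left_module.intro left_module_axioms.intro R.ring_axioms M.abelian_group_axioms)
    (auto simp: smult_l_distr smult_r_distr smult_assoc1)

text \<open>Closure under negation comes for free, since \<open>- x = (- 1) x\<close>.\<close>

lemma (in module) submoduleI_closed:
  assumes "H \<subseteq> carrier M" and "\<zero>\<^bsub>M\<^esub> \<in> H"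
    and "\<And>x y. \<lbrakk>x \<in> H; y \<in> H\<rbrakk> \<Longrightarrow> x \<oplus>\<^bsub>M\<^esub> y \<in> H"
    and "\<And>r x. \<lbrakk>r \<in> carrier R; x \<in> H\<rbrakk> \<Longrightarrow> r \<odot>\<^bsub>M\<^esub> x \<in> H"
  shows "submodule H R M"
proof (rule submoduleI)
  fix x assume "x \<in> H"
  then have "\<ominus>\<^bsub>M\<^esub> x = (\<ominus> \<one>) \<odot>\<^bsub>M\<^esub> x"
    using assms(1) by (subst smult_l_minus) auto
  then show "\<ominus>\<^bsub>M\<^esub> x \<in> H"
    using assms(4)[of "\<ominus> \<one>" x] \<open>x \<in> H\<close> by simp
qed (use assms in auto)

lemma (in module) submodule_zero_closed:
  assumes "submodule H R M"
  shows "\<zero>\<^bsub>M\<^esub> \<in> H"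
  using subgroup.one_closed[OF submodule.axioms(1)[OF assms]] by simp

lemma (in module) submodule_abelian_subgroup:
  assumes "submodule N R M"
  shows "abelian_subgroup N M"
  using assms submodule.axioms(1) M.abelian_group_axioms
  by (intro abelian_subgroupI3 additive_subgroupI) auto

lemma (in module) carrier_quotient_module:
  "carrier (quotient_module M N) = (\<lambda>x. N +>\<^bsub>M\<^esub> x) ` carrier M"
  by (auto simp: quotient_module_def A_RCOSETS_def')

lemma (in module) add_quotient_module:
  assumes "submodule N R M" "x \<in> carrier M" "y \<in> carrier M"
  shows "(N +>\<^bsub>M\<^esub> x) \<oplus>\<^bsub>quotient_module M N\<^esub> (N +>\<^bsub>M\<^esub> y) = N +>\<^bsub>M\<^esub> (x \<oplus>\<^bsub>M\<^esub> y)"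
proof -
  interpret N: abelian_subgroup N M using submodule_abelian_subgroup[OF assms(1)] .
  show ?thesis using assms by (simp add: quotient_module_def N.a_rcos_sum)
qed

lemma (in module) rcos_eq_iff:
  assumes "submodule N R M" "x \<in> carrier M" "y \<in> carrier M"
  shows "N +>\<^bsub>M\<^esub> x = N +>\<^bsub>M\<^esub> y \<longleftrightarrow> x \<ominus>\<^bsub>M\<^esub> y \<in> N"
proof -
  interpret N: abelian_subgroup N M using submodule_abelian_subgroup[OF assms(1)] .
  have "N +>\<^bsub>M\<^esub> x = N +>\<^bsub>M\<^esub> y \<longleftrightarrow> x \<in> N +>\<^bsub>M\<^esub> y"
    using N.a_repr_independence'[OF _ assms(3)] N.a_rcos_self[OF assms(2)] by metis
  then show ?thesis
    using N.a_rcos_module[OF assms(3,2)] by (simp add: a_minus_def)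
qed

lemma (in module) smult_quotient_module:
  assumes N: "submodule N R M" and r: "r \<in> carrier R" and x: "x \<in> carrier M"
  shows "r \<odot>\<^bsub>quotient_module M N\<^esub> (N +>\<^bsub>M\<^esub> x) = N +>\<^bsub>M\<^esub> (r \<odot>\<^bsub>M\<^esub> x)"
proof -
  interpret N: abelian_subgroup N M using submodule_abelian_subgroup[OF N] .
  have "N +>\<^bsub>M\<^esub> (r \<odot>\<^bsub>M\<^esub> y) = N +>\<^bsub>M\<^esub> (r \<odot>\<^bsub>M\<^esub> x)" if "y \<in> N +>\<^bsub>M\<^esub> x" for y
  proof -
    have y: "y \<in> carrier M" using that N.a_elemrcos_carrier x by blast
    have "y \<ominus>\<^bsub>M\<^esub> x \<in> N"
      using that x y N.a_rcos_module[of x y] by (simp add: a_minus_def)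
    then have "r \<odot>\<^bsub>M\<^esub> (y \<ominus>\<^bsub>M\<^esub> x) \<in> N"
      using submodule.smult_closed[OF N r] by blast
    moreover have "r \<odot>\<^bsub>M\<^esub> (y \<ominus>\<^bsub>M\<^esub> x) = r \<odot>\<^bsub>M\<^esub> y \<ominus>\<^bsub>M\<^esub> r \<odot>\<^bsub>M\<^esub> x"
      using r x y by (simp add: a_minus_def smult_r_distr smult_r_minus)
    ultimately show ?thesis using rcos_eq_iff[OF N] r x y by simp
  qed
  moreover have "x \<in> N +>\<^bsub>M\<^esub> x" using x N.a_rcos_self by blast
  ultimately have "(\<Union>y\<in>N +>\<^bsub>M\<^esub> x. N +>\<^bsub>M\<^esub> (r \<odot>\<^bsub>M\<^esub> y)) = N +>\<^bsub>M\<^esub> (r \<odot>\<^bsub>M\<^esub> x)"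
    by (intro SUP_eq_const) blast+
  then show ?thesis by (simp add: quotient_module_def)
qed

lemma (in module) quotient_module:
  assumes N: "submodule N R M"
  shows "module R (quotient_module M N)"
proof -
  interpret N: abelian_subgroup N M using submodule_abelian_subgroup[OF N] .
  let ?Q = "quotient_module M N"
  have zero: "\<zero>\<^bsub>?Q\<^esub> = N +>\<^bsub>M\<^esub> \<zero>\<^bsub>M\<^esub>"
    using N.a_subset by (simp add: quotient_module_def)
  have coset: "\<exists>x\<in>carrier M. X = N +>\<^bsub>M\<^esub> x" if "X \<in> carrier ?Q" for X
    using that by (auto simp: carrier_quotient_module)
  have coset_carrier: "N +>\<^bsub>M\<^esub> x \<in> carrier ?Q" if "x \<in> carrier M" for x
    using that by (auto simp: carrier_quotient_module)
  note Q_simps = add_quotient_module[OF N] smult_quotient_module[OF N]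
  have "abelian_group ?Q"
  proof (rule abelian_groupI)
    show "\<zero>\<^bsub>?Q\<^esub> \<in> carrier ?Q" unfolding zero by (rule coset_carrier) simp
  next
    fix X Y assume "X \<in> carrier ?Q" "Y \<in> carrier ?Q"
    then obtain x y where "x \<in> carrier M" "y \<in> carrier M" "X = N +>\<^bsub>M\<^esub> x" "Y = N +>\<^bsub>M\<^esub> y"
      using coset by blast
    then show "X \<oplus>\<^bsub>?Q\<^esub> Y \<in> carrier ?Q" and "X \<oplus>\<^bsub>?Q\<^esub> Y = Y \<oplus>\<^bsub>?Q\<^esub> X"
      by (simp_all add: Q_simps coset_carrier M.a_comm)
  next
    fix X Y Z assume "X \<in> carrier ?Q" "Y \<in> carrier ?Q" "Z \<in> carrier ?Q"
    then obtain x y z where "x \<in> carrier M" "y \<in> carrier M" "z \<in> carrier M"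
        "X = N +>\<^bsub>M\<^esub> x" "Y = N +>\<^bsub>M\<^esub> y" "Z = N +>\<^bsub>M\<^esub> z"
      using coset by meson
    then show "X \<oplus>\<^bsub>?Q\<^esub> Y \<oplus>\<^bsub>?Q\<^esub> Z = X \<oplus>\<^bsub>?Q\<^esub> (Y \<oplus>\<^bsub>?Q\<^esub> Z)"
      by (simp add: Q_simps M.a_assoc)
  next
    fix X assume "X \<in> carrier ?Q"
    then obtain x where x: "x \<in> carrier M" "X = N +>\<^bsub>M\<^esub> x" using coset by blast
    then show "\<zero>\<^bsub>?Q\<^esub> \<oplus>\<^bsub>?Q\<^esub> X = X" by (simp add: zero Q_simps)
    show "\<exists>Y\<in>carrier ?Q. Y \<oplus>\<^bsub>?Q\<^esub> X = \<zero>\<^bsub>?Q\<^esub>"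
      using x coset_carrier[of "\<ominus>\<^bsub>M\<^esub> x"]
      by (intro bexI[of _ "N +>\<^bsub>M\<^esub> (\<ominus>\<^bsub>M\<^esub> x)"]) (simp_all add: zero Q_simps M.l_neg)
  qed
  then show ?thesis
  proof (intro moduleI R.is_cring)
    fix r s X assume rs: "r \<in> carrier R" "s \<in> carrier R" and "X \<in> carrier ?Q"
    then obtain x where "x \<in> carrier M" "X = N +>\<^bsub>M\<^esub> x" using coset by blast
    then show "(r \<oplus> s) \<odot>\<^bsub>?Q\<^esub> X = r \<odot>\<^bsub>?Q\<^esub> X \<oplus>\<^bsub>?Q\<^esub> s \<odot>\<^bsub>?Q\<^esub> X"
      "r \<otimes> s \<odot>\<^bsub>?Q\<^esub> X = r \<odot>\<^bsub>?Q\<^esub> (s \<odot>\<^bsub>?Q\<^esub> X)"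
      using rs by (simp_all add: Q_simps smult_l_distr smult_assoc1)
  next
    show "r \<odot>\<^bsub>?Q\<^esub> X \<in> carrier ?Q" if "r \<in> carrier R" "X \<in> carrier ?Q" for r X
      using that coset[of X] by (auto simp: Q_simps coset_carrier)
    show "\<one> \<odot>\<^bsub>?Q\<^esub> X = X" if "X \<in> carrier ?Q" for X
      using coset[OF that] by (auto simp: Q_simps)
  next
    fix r X Y assume r: "r \<in> carrier R" and "X \<in> carrier ?Q" "Y \<in> carrier ?Q"
    then obtain x y where "x \<in> carrier M" "y \<in> carrier M" "X = N +>\<^bsub>M\<^esub> x" "Y = N +>\<^bsub>M\<^esub> y"
      using coset by blast
    then show "r \<odot>\<^bsub>?Q\<^esub> (X \<oplus>\<^bsub>?Q\<^esub> Y) = r \<odot>\<^bsub>?Q\<^esub> X \<oplus>\<^bsub>?Q\<^esub> r \<odot>\<^bsub>?Q\<^esub> Y"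
      using r by (simp add: Q_simps smult_r_distr)
  qed
qed

text \<open>A composition series of \<open>D n / D 0\<close>, written in \<open>M\<close>. Leaving \<open>D 0\<close> arbitrary allows one
filtration by submodules of \<open>M\<close> to compute both the length of \<open>M\<close> (when \<open>D 0\<close> is zero) and the
length of a quotient of \<open>M\<close>, without any computation with cosets.\<close>

definition composition_chain ::
    "('a, 'm) ring_scheme \<Rightarrow> ('a, 'b, 'n) module_scheme \<Rightarrow> (nat \<Rightarrow> 'b set) \<Rightarrow> nat \<Rightarrow> bool" where
  "composition_chain A M D n \<longleftrightarrow> (\<forall>i\<le>n. submodule (D i) A M) \<and>
     (\<forall>i<n. D i \<subset> D (Suc i) \<and> \<not> (\<exists>N. submodule N A M \<and> D i \<subset> N \<and> N \<subset> D (Suc i)))"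

lemma has_length_composition_chain:
  assumes "composition_chain A M D n" "D 0 = {\<zero>\<^bsub>M\<^esub>}" "D n = carrier M"
  shows "has_length A M n"
  using assms unfolding has_length_def composition_chain_def by blast

text \<open>The correspondence between submodules of \<open>M / D 0\<close> and submodules of \<open>M\<close> containing \<open>D 0\<close>: taking
images along the projection keeps the inclusions of the chain strict, and a submodule of the quotient
strictly between two images would have as preimage a submodule strictly between two terms of the chain.\<close>

lemma (in module) has_length_quotient_module:
  assumes chain: "composition_chain R M D n" and n: "D n = carrier M"
  shows "has_length R (quotient_module M (D 0)) n"
proof -
  let ?Q = "quotient_module M (D 0)"
  let ?p = "\<lambda>x. D 0 +>\<^bsub>M\<^esub> x"
  have sub: "submodule (D i) R M" if "i \<le> n" for i
    using chain that unfolding composition_chain_def by blast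
  have step: "D i \<subset> D (Suc i)" if "i < n" for i
    using chain that unfolding composition_chain_def by blast
  have simple: "\<not> (D i \<subset> N \<and> N \<subset> D (Suc i))" if "i < n" "submodule N R M" for i N
    using chain that unfolding composition_chain_def by blast
  have N: "submodule (D 0) R M" using sub by simp
  interpret N: abelian_subgroup "D 0" M using submodule_abelian_subgroup[OF N] .
  interpret Q: module R ?Q using quotient_module[OF N] .
  have D0: "D 0 \<subseteq> D i" if "i \<le> n" for i
    using that by (induction i) (use step in \<open>auto simp: Suc_le_eq\<close>)
  have carr: "D i \<subseteq> carrier M" if "i \<le> n" for i
    using submoduleE(1)[OF sub[OF that]] .
  \<comment> \<open>Each \<open>D i\<close> contains \<open>D 0\<close>, so it is saturated for the projection.\<close>
  have mem: "x \<in> D i \<longleftrightarrow> ?p x \<in> ?p ` D i" if "i \<le> n" "x \<in> carrier M" for i x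
  proof
    assume "?p x \<in> ?p ` D i"
    then obtain d where d: "d \<in> D i" "?p x = ?p d" by blast
    have dM: "d \<in> carrier M" using d carr that by blast
    have "x \<ominus>\<^bsub>M\<^esub> d \<in> D i"
      using rcos_eq_iff[OF N that(2) dM] d D0[OF that(1)] by blast
    then have "(x \<ominus>\<^bsub>M\<^esub> d) \<oplus>\<^bsub>M\<^esub> d \<in> D i"
      using submoduleE(5)[OF sub[OF that(1)]] d by blast
    then show "x \<in> D i"
      using that dM by (simp add: a_minus_def M.a_assoc M.l_neg)
  qed auto
  have subQ: "submodule (?p ` D i) R ?Q" if "i \<le> n" for i
  proof (rule Q.submoduleI_closed)
    show "?p ` D i \<subseteq> carrier ?Q"
      using carr[OF that] by (auto simp: carrier_quotient_module)
    have "?p \<zero>\<^bsub>M\<^esub> = \<zero>\<^bsub>?Q\<^esub>"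
      using N.a_subset by (simp add: quotient_module_def)
    then show "\<zero>\<^bsub>?Q\<^esub> \<in> ?p ` D i"
      using submodule_zero_closed[OF sub[OF that]] by (metis imageI)
  next
    fix X Y assume "X \<in> ?p ` D i" "Y \<in> ?p ` D i"
    then show "X \<oplus>\<^bsub>?Q\<^esub> Y \<in> ?p ` D i"
      using carr[OF that] submoduleE(5)[OF sub[OF that]] add_quotient_module[OF N]
      by (smt (verit) image_iff subsetD)
  next
    fix r X assume "r \<in> carrier R" "X \<in> ?p ` D i"
    then show "r \<odot>\<^bsub>?Q\<^esub> X \<in> ?p ` D i"
      using carr[OF that] submoduleE(4)[OF sub[OF that]] smult_quotient_module[OF N]
      by (smt (verit) image_iff subsetD)
  qed
  have simpleQ: "\<not> (?p ` D i \<subset> X \<and> X \<subset> ?p ` D (Suc i))"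
    if i: "i < n" and X: "submodule X R ?Q" for i X
  proof
    assume between: "?p ` D i \<subset> X \<and> X \<subset> ?p ` D (Suc i)"
    define P where "P = {x \<in> carrier M. ?p x \<in> X}"
    have "submodule P R M"
    proof (rule submoduleI_closed)
      show "\<zero>\<^bsub>M\<^esub> \<in> P"
        using between submodule_zero_closed[OF sub[of i]] i by (auto simp: P_def)
      show "x \<oplus>\<^bsub>M\<^esub> y \<in> P" if "x \<in> P" "y \<in> P" for x y
        using that Q.submoduleE(5)[OF X] add_quotient_module[OF N, of x y]
        by (force simp: P_def)
      show "r \<odot>\<^bsub>M\<^esub> x \<in> P" if "r \<in> carrier R" "x \<in> P" for r x
        using that Q.submoduleE(4)[OF X] smult_quotient_module[OF N, of r x]
        by (force simp: P_def)
    qed (auto simp: P_def)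
    moreover have "X = ?p ` P"
      using Q.submoduleE(1)[OF X] by (auto simp: P_def carrier_quotient_module)
    then have "D i \<subset> P \<and> P \<subset> D (Suc i)"
      using between mem[of i] mem[of "Suc i"] i carr[of i] by (auto simp: P_def)
    ultimately show False using simple[OF i] by blast
  qed
  show ?thesis
  proof (rule has_length_composition_chain)
    show "composition_chain R ?Q (\<lambda>i. ?p ` D i) n"
      unfolding composition_chain_def
    proof (intro conjI allI impI)
      show "submodule (?p ` D i) R ?Q" if "i \<le> n" for i using subQ[OF that] .
    next
      fix i assume i: "i < n"
      obtain d where "d \<in> D (Suc i)" "d \<notin> D i" using step[OF i] by blast
      then show "?p ` D i \<subset> ?p ` D (Suc i)"
        using step[OF i] mem[of i d] carr[of "Suc i"] i by (auto simp: Suc_le_eq)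
      show "\<not> (\<exists>X. submodule X R ?Q \<and> ?p ` D i \<subset> X \<and> X \<subset> ?p ` D (Suc i))"
      proof
        assume "\<exists>X. submodule X R ?Q \<and> ?p ` D i \<subset> X \<and> X \<subset> ?p ` D (Suc i)"
        then obtain X where "submodule X R ?Q" "?p ` D i \<subset> X \<and> X \<subset> ?p ` D (Suc i)" by iprover
        then show False using simpleQ[OF i] by iprover
      qed
    qed
    have "?p ` D 0 = (\<lambda>_. D 0) ` D 0"
      by (rule image_cong) (simp_all add: N.a_rcos_const)
    also have "\<dots> = {D 0}"
      using submodule_zero_closed[OF N] by (rule image_constant)
    finally show "?p ` D 0 = {\<zero>\<^bsub>?Q\<^esub>}" by (simp add: quotient_module_def)
    show "?p ` D n = carrier ?Q" by (simp add: n carrier_quotient_module)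
  qed
qed

section \<open>Ideals of a commutative ring as modules\<close>

lemma regular_module_simps [simp]:
  "carrier (regular_module A) = carrier A"
  "zero (regular_module A) = zero A"
  "add (regular_module A) = add A"
  "smult (regular_module A) = mult A"
  by (simp_all add: regular_module_def)

lemma (in cring) module_regular_module: "module R (regular_module R)"
proof (rule moduleI)
  show "abelian_group (regular_module R)"
  proof (rule abelian_groupI)
    show "\<exists>y\<in>carrier (regular_module R).
        y \<oplus>\<^bsub>regular_module R\<^esub> x = \<zero>\<^bsub>regular_module R\<^esub>"
      if "x \<in> carrier (regular_module R)" for x
      using that by (intro bexI[of _ "\<ominus> x"]) (simp_all add: l_neg)
  qed (simp_all add: a_ac)
qed (auto simp: l_distr r_distr m_assoc is_cring)

lemma (in cring) submodule_regular_iff_ideal: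
  "submodule I R (regular_module R) \<longleftrightarrow> ideal I R"
proof
  interpret M: module R "regular_module R" using module_regular_module .
  {
    assume I: "submodule I R (regular_module R)"
    have *: "I \<subseteq> carrier R" "\<And>x y. x \<in> I \<Longrightarrow> y \<in> I \<Longrightarrow> x \<oplus> y \<in> I"
        "\<And>r x. r \<in> carrier R \<Longrightarrow> x \<in> I \<Longrightarrow> r \<otimes> x \<in> I"
      using M.submoduleE[OF I] by auto
    show "ideal I R"
    proof (rule idealI)
      show "subgroup I (add_monoid R)"
      proof (rule add.subgroupI)
        fix x assume "x \<in> I"
        moreover from this have "\<ominus> x = (\<ominus> \<one>) \<otimes> x"
          using * by (simp add: l_minus subset_iff)
        ultimately show "\<ominus> x \<in> I" using *(3)[of "\<ominus> \<one>" x] by simp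
      qed (use * M.submodule_zero_closed[OF I] in auto)
      fix x r assume x: "x \<in> I" and r: "r \<in> carrier R"
      show "r \<otimes> x \<in> I" using *(3)[OF r x] .
      moreover have "x \<otimes> r = r \<otimes> x" using m_comm[of x r] x r *(1) by blast
      ultimately show "x \<otimes> r \<in> I" by simp
    qed (rule ring_axioms)
  next
    assume "ideal I R"
    then interpret ideal I R .
    show "submodule I R (regular_module R)"
      by (rule M.submoduleI_closed) (auto simp: a_subset I_l_closed)
  }
qed

lemma (in cring) module_ideal:
  assumes "ideal I R"
  shows "module R ((regular_module R)\<lparr>carrier := I\<rparr>)"
  using assms submodule.submodule_is_module module_regular_module submodule_regular_iff_ideal
  by blast

lemma (in cring) submodule_ideal:
  assumes "ideal I R" "ideal T R" "I \<subseteq> T"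
  shows "submodule I R ((regular_module R)\<lparr>carrier := T\<rparr>)"
proof -
  interpret M: module R "(regular_module R)\<lparr>carrier := T\<rparr>" using module_ideal assms by blast
  interpret I: ideal I R by fact
  show ?thesis
    by (rule M.submoduleI_closed) (use assms in \<open>auto simp: I.I_l_closed\<close>)
qed

section \<open>Reflexive principal ideals\<close>

text \<open>A homomorphism \<open>f\<close> from \<open>Rx\<close> to \<open>R\<close> is determined by \<open>f x\<close>, and the possible values are exactly the
elements annihilated by \<open>ann x\<close>. If \<open>ann (ann x) = Rx\<close>, these values are the multiples of \<open>x\<close>, so the
dual of \<open>Rx\<close> is generated by the inclusion \<open>\<iota>\<close> of \<open>Rx\<close> into \<open>R\<close>, and \<open>\<iota>\<close> has the same annihilator
as \<open>x\<close>. Hence a linear map \<open>\<phi>\<close> from the dual to \<open>R\<close> is determined by \<open>\<phi> \<iota>\<close>, this value again lies in \<open>Rx\<close>, and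
\<open>\<phi>\<close> is the evaluation at \<open>\<phi> \<iota>\<close>. Evaluation is injective because it can be tested on \<open>\<iota>\<close>.\<close>

lemma (in cring) reflexive_principal_ideal:
  assumes x: "x \<in> carrier R"
    and double_annihilator:
      "\<And>u. \<lbrakk>u \<in> carrier R; \<And>b. \<lbrakk>b \<in> carrier R; b \<otimes> x = \<zero>\<rbrakk> \<Longrightarrow> b \<otimes> u = \<zero>\<rbrakk> \<Longrightarrow> u \<in> PIdl x"
  shows "reflexive_module R ((regular_module R)\<lparr>carrier := PIdl x\<rparr>)"
proof -
  define M where "M = (regular_module R)\<lparr>carrier := PIdl x\<rparr>"
  have M [simp]: "carrier M = PIdl x" "zero M = \<zero>" "add M = add R" "smult M = mult R"
    by (simp_all add: M_def)
  interpret I: ideal "PIdl x" R using cgenideal_ideal[OF x] .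
  define D where "D = dual R M"
  define D' where "D' = dual (opposite R) D"
  define \<iota> where "\<iota> = (\<lambda>y\<in>PIdl x. y)"
  have xI: "x \<in> PIdl x" using cgenideal_self[OF x] .
  have PI: "\<exists>c\<in>carrier R. y = c \<otimes> x" if "y \<in> PIdl x" for y
    using that unfolding cgenideal_def by blast
  have D_iff: "f \<in> carrier D \<longleftrightarrow> f \<in> PIdl x \<rightarrow>\<^sub>E carrier R \<and>
      (\<forall>y\<in>PIdl x. \<forall>z\<in>PIdl x. f (y \<oplus> z) = f y \<oplus> f z) \<and>
      (\<forall>r\<in>carrier R. \<forall>y\<in>PIdl x. f (r \<otimes> y) = r \<otimes> f y)" for f
    by (simp add: D_def dual_def linear_maps_def)
  have smult_D: "r \<odot>\<^bsub>D\<^esub> f = (\<lambda>y\<in>PIdl x. f y \<otimes> r)" for r f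
    by (simp add: D_def dual_def)
  have add_D: "f \<oplus>\<^bsub>D\<^esub> g = (\<lambda>y\<in>PIdl x. f y \<oplus> g y)" for f g
    by (simp add: D_def dual_def)
  have D'_iff: "\<phi> \<in> carrier D' \<longleftrightarrow> \<phi> \<in> carrier D \<rightarrow>\<^sub>E carrier R \<and>
      (\<forall>f\<in>carrier D. \<forall>g\<in>carrier D. \<phi> (f \<oplus>\<^bsub>D\<^esub> g) = \<phi> f \<oplus> \<phi> g) \<and>
      (\<forall>r\<in>carrier R. \<forall>f\<in>carrier D. \<phi> (r \<odot>\<^bsub>D\<^esub> f) = \<phi> f \<otimes> r)" for \<phi>
    unfolding D'_def dual_def[of "opposite R"] by (simp add: linear_maps_def opposite_def)
  have \<iota>: "\<iota> \<in> carrier D"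
    unfolding D_iff \<iota>_def by (auto simp: I.I_l_closed)
  have closed: "f y \<in> carrier R" if "f \<in> carrier D" "y \<in> PIdl x" for f y
    using that by (auto simp: D_iff PiE_mem)
  have smult_closed_D: "r \<odot>\<^bsub>D\<^esub> f \<in> carrier D" if r: "r \<in> carrier R" and f: "f \<in> carrier D" for r f
    using r f closed[OF f] unfolding D_iff smult_D
    by (simp add: restrict_PiE_iff I.I_l_closed l_distr m_assoc)
  have add_closed_D: "f \<oplus>\<^bsub>D\<^esub> g \<in> carrier D" if f: "f \<in> carrier D" and g: "g \<in> carrier D" for f g
    using f g closed[OF f] closed[OF g] unfolding D_iff add_D
    by (simp add: restrict_PiE_iff I.I_l_closed r_distr a_ac)
  \<comment> \<open>The value \<open>f x\<close> is annihilated by everything that annihilates \<open>x\<close>.\<close>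
  have D_smult: "\<exists>c\<in>carrier R. f = c \<odot>\<^bsub>D\<^esub> \<iota>" if f: "f \<in> carrier D" for f
  proof -
    have lin: "f (r \<otimes> y) = r \<otimes> f y" if "r \<in> carrier R" "y \<in> PIdl x" for r y
      using that f by (simp add: D_iff)
    have "f x \<in> PIdl x"
    proof (rule double_annihilator)
      fix b assume b: "b \<in> carrier R" "b \<otimes> x = \<zero>"
      have "b \<otimes> f x = f (\<zero> \<otimes> x)" using lin[OF b(1) xI] b x by simp
      also have "\<dots> = \<zero>" using lin[of \<zero> x] xI closed[OF f xI] by simp
      finally show "b \<otimes> f x = \<zero>" .
    qed (rule closed[OF f xI])
    then obtain c where c: "c \<in> carrier R" "f x = c \<otimes> x" using PI by blast
    have "f = c \<odot>\<^bsub>D\<^esub> \<iota>"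
    proof
      fix y
      show "f y = (c \<odot>\<^bsub>D\<^esub> \<iota>) y"
      proof (cases "y \<in> PIdl x")
        case True
        then obtain d where d: "d \<in> carrier R" "y = d \<otimes> x" using PI by blast
        have "f y = d \<otimes> (c \<otimes> x)" using d c lin[OF d(1) xI] by simp
        also have "\<dots> = d \<otimes> x \<otimes> c" using d c x by (simp add: m_ac)
        finally show ?thesis using True d by (simp add: smult_D \<iota>_def)
      next
        case False
        then show ?thesis using f PiE_arb[of f "PIdl x" _ y] by (auto simp: D_iff smult_D)
      qed
    qed
    then show ?thesis using c by blast
  qed
  have eval: "(\<lambda>\<alpha>\<in>carrier D. \<alpha> m) \<in> carrier D'" if "m \<in> PIdl x" for m
    unfolding D'_iff using that smult_closed_D add_closed_D closed
    by (auto simp: smult_D add_D)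
  have "inj_on (\<lambda>m. \<lambda>\<alpha>\<in>carrier D. \<alpha> m) (PIdl x)"
  proof (rule inj_onI)
    fix y z assume yz: "y \<in> PIdl x" "z \<in> PIdl x"
      and eq: "(\<lambda>\<alpha>\<in>carrier D. \<alpha> y) = (\<lambda>\<alpha>\<in>carrier D. \<alpha> z)"
    show "y = z" using fun_cong[OF eq, of \<iota>] \<iota> yz by (simp add: \<iota>_def)
  qed
  moreover have "\<exists>v\<in>PIdl x. \<phi> = (\<lambda>\<alpha>\<in>carrier D. \<alpha> v)" if \<phi>: "\<phi> \<in> carrier D'" for \<phi>
  proof -
    have lin: "\<phi> (r \<odot>\<^bsub>D\<^esub> f) = \<phi> f \<otimes> r" if "r \<in> carrier R" "f \<in> carrier D" for r f
      using that \<phi> by (simp add: D'_iff)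
    have \<phi>\<iota>: "\<phi> \<iota> \<in> carrier R" using \<phi> \<iota> by (auto simp: D'_iff PiE_mem)
    have v: "\<phi> \<iota> \<in> PIdl x"
    proof (rule double_annihilator)
      fix b assume b: "b \<in> carrier R" "b \<otimes> x = \<zero>"
      have "y \<otimes> b = y \<otimes> \<zero>" if "y \<in> PIdl x" for y
      proof -
        obtain d where d: "d \<in> carrier R" "y = d \<otimes> x" using PI \<open>y \<in> PIdl x\<close> by blast
        then have "y \<otimes> b = d \<otimes> (b \<otimes> x)" using b(1) x by (simp add: m_ac)
        then show ?thesis using b d x by simp
      qed
      then have "b \<odot>\<^bsub>D\<^esub> \<iota> = \<zero> \<odot>\<^bsub>D\<^esub> \<iota>" by (auto simp: smult_D \<iota>_def)
      then show "b \<otimes> \<phi> \<iota> = \<zero>"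
        using lin[of b \<iota>] lin[of \<zero> \<iota>] b \<iota> \<phi>\<iota> by (simp add: m_comm)
    qed (rule \<phi>\<iota>)
    have "\<phi> f = f (\<phi> \<iota>)" if f: "f \<in> carrier D" for f
    proof -
      obtain c where "c \<in> carrier R" "f = c \<odot>\<^bsub>D\<^esub> \<iota>" using D_smult[OF f] by blast
      then show ?thesis using lin[of c \<iota>] \<iota> v by (simp add: smult_D \<iota>_def)
    qed
    then have "\<phi> = (\<lambda>\<alpha>\<in>carrier D. \<alpha> (\<phi> \<iota>))"
      using \<phi> by (auto simp: D'_iff PiE_iff extensional_def)
    then show ?thesis using v by blast
  qed
  ultimately have "bij_betw (\<lambda>m. \<lambda>\<alpha>\<in>carrier D. \<alpha> m) (PIdl x) (carrier D')"
    using eval unfolding bij_betw_def by blast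
  then show ?thesis unfolding reflexive_module_def D_def D'_def M_def[symmetric] by simp
qed

section \<open>Local algebras defined by a bilinear map\<close>

text \<open>The algebra \<open>k \<oplus> V \<oplus> W\<close> with \<open>dim V = e\<close> and \<open>dim W = a\<close>, where a product of two vectors of \<open>V\<close> is given
by a symmetric bilinear map from \<open>V \<times> V\<close> to \<open>W\<close> and \<open>W\<close> multiplies \<open>V \<oplus> W\<close> to zero. An element is the
sequence of its coordinates: position \<open>0\<close> belongs to \<open>k\<close>, the positions \<open>1, ..., e\<close> to \<open>V\<close> and the
positions \<open>e + 1, ..., e + a\<close> to \<open>W\<close>; all further coordinates are zero. \<open>\<beta> k\<close> is the component at
position \<open>k\<close> of the bilinear map.

The single axiom \<open>form_linear\<close> expresses linearity and also that \<open>\<beta>\<close> sees only the coordinates of \<open>V\<close>,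
because its hypothesis on \<open>w\<close> is restricted to these. It applies to a product, whose \<open>V\<close>-part is
a linear combination of the \<open>V\<close>-parts of the factors although the product itself is not.\<close>

locale bilinear_local_algebra = field K for K (structure) +
  fixes e a :: nat and \<beta> :: "nat \<Rightarrow> (nat \<Rightarrow> 'a) \<Rightarrow> (nat \<Rightarrow> 'a) \<Rightarrow> 'a"
  assumes form_closed:
      "\<lbrakk>\<And>i. u i \<in> carrier K; \<And>i. v i \<in> carrier K\<rbrakk> \<Longrightarrow> \<beta> k u v \<in> carrier K"
    and form_comm:
      "\<lbrakk>\<And>i. u i \<in> carrier K; \<And>i. v i \<in> carrier K\<rbrakk> \<Longrightarrow> \<beta> k u v = \<beta> k v u"
    and form_linear:
      "\<lbrakk>\<And>i. u i \<in> carrier K; \<And>i. v i \<in> carrier K; \<And>i. w i \<in> carrier K; \<And>i. z i \<in> carrier K;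
        c \<in> carrier K; d \<in> carrier K;
        \<And>i. \<lbrakk>1 \<le> i; i \<le> e\<rbrakk> \<Longrightarrow> w i = c \<otimes> u i \<oplus> d \<otimes> v i\<rbrakk> \<Longrightarrow>
        \<beta> k w z = c \<otimes> \<beta> k u z \<oplus> d \<otimes> \<beta> k v z"
begin

definition alg :: "('a, nat \<Rightarrow> 'a) module" where
  "alg = \<lparr>carrier = {u. (\<forall>i. u i \<in> carrier K) \<and> (\<forall>i. i > e + a \<longrightarrow> u i = \<zero>)},
     mult = (\<lambda>u v k. if k = 0 then u 0 \<otimes> v 0
        else if k \<le> e then u 0 \<otimes> v k \<oplus> v 0 \<otimes> u k
        else if k \<le> e + a then u 0 \<otimes> v k \<oplus> v 0 \<otimes> u k \<oplus> \<beta> k u v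
        else \<zero>),
     one = (\<lambda>k. if k = 0 then \<one> else \<zero>), zero = (\<lambda>k. \<zero>), add = (\<lambda>u v k. u k \<oplus> v k),
     smult = (\<lambda>c u k. c \<otimes> u k)\<rparr>"

lemma alg_carrierI:
  "\<lbrakk>\<And>i. u i \<in> carrier K; \<And>i. i > e + a \<Longrightarrow> u i = \<zero>\<rbrakk> \<Longrightarrow> u \<in> carrier alg"
  by (simp add: alg_def)

lemma coeff_closed: "u \<in> carrier alg \<Longrightarrow> u i \<in> carrier K"
  by (simp add: alg_def)

lemma coeff_outside: "u \<in> carrier alg \<Longrightarrow> i > e + a \<Longrightarrow> u i = \<zero>"
  by (simp add: alg_def)

lemma alg_mult:
  "(u \<otimes>\<^bsub>alg\<^esub> v) k = (if k = 0 then u 0 \<otimes> v 0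
        else if k \<le> e then u 0 \<otimes> v k \<oplus> v 0 \<otimes> u k
        else if k \<le> e + a then u 0 \<otimes> v k \<oplus> v 0 \<otimes> u k \<oplus> \<beta> k u v
        else \<zero>)"
  by (simp add: alg_def)

lemma alg_add: "(u \<oplus>\<^bsub>alg\<^esub> v) k = u k \<oplus> v k"
  by (simp add: alg_def)

lemma alg_zero: "\<zero>\<^bsub>alg\<^esub> k = \<zero>"
  by (simp add: alg_def)

lemma alg_one: "\<one>\<^bsub>alg\<^esub> k = (if k = 0 then \<one> else \<zero>)"
  by (simp add: alg_def)

lemma alg_smult: "(c \<odot>\<^bsub>alg\<^esub> u) k = c \<otimes> u k"
  by (simp add: alg_def)

lemma form_alg_closed: "\<lbrakk>u \<in> carrier alg; v \<in> carrier alg\<rbrakk> \<Longrightarrow> \<beta> k u v \<in> carrier K"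
  by (rule form_closed) (simp_all add: coeff_closed)

lemma form_alg_comm: "\<lbrakk>u \<in> carrier alg; v \<in> carrier alg\<rbrakk> \<Longrightarrow> \<beta> k u v = \<beta> k v u"
  by (rule form_comm) (simp_all add: coeff_closed)

lemma form_zero:
  assumes "u \<in> carrier alg" "v \<in> carrier alg" "\<And>i. \<lbrakk>1 \<le> i; i \<le> e\<rbrakk> \<Longrightarrow> u i = \<zero>"
  shows "\<beta> k u v = \<zero>"
proof -
  have "\<beta> k u v = \<zero> \<otimes> \<beta> k u v \<oplus> \<zero> \<otimes> \<beta> k u v"
    by (rule form_linear) (use assms in \<open>simp_all add: coeff_closed\<close>)
  then show ?thesis using form_alg_closed[OF assms(1,2)] by simp
qed

lemma form_add:
  assumes "u \<in> carrier alg" "v \<in> carrier alg" "z \<in> carrier alg"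
  shows "\<beta> k (u \<oplus>\<^bsub>alg\<^esub> v) z = \<beta> k u z \<oplus> \<beta> k v z"
proof -
  have "\<beta> k (u \<oplus>\<^bsub>alg\<^esub> v) z = \<one> \<otimes> \<beta> k u z \<oplus> \<one> \<otimes> \<beta> k v z"
    by (rule form_linear) (use assms in \<open>simp_all add: coeff_closed alg_add\<close>)
  then show ?thesis using form_alg_closed assms by simp
qed

lemma alg_closed:
  shows alg_mult_closed: "\<lbrakk>u \<in> carrier alg; v \<in> carrier alg\<rbrakk> \<Longrightarrow> u \<otimes>\<^bsub>alg\<^esub> v \<in> carrier alg"
    and alg_add_closed: "\<lbrakk>u \<in> carrier alg; v \<in> carrier alg\<rbrakk> \<Longrightarrow> u \<oplus>\<^bsub>alg\<^esub> v \<in> carrier alg"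
    and alg_smult_closed: "\<lbrakk>c \<in> carrier K; u \<in> carrier alg\<rbrakk> \<Longrightarrow> c \<odot>\<^bsub>alg\<^esub> u \<in> carrier alg"
    and alg_one_closed: "\<one>\<^bsub>alg\<^esub> \<in> carrier alg"
    and alg_zero_closed: "\<zero>\<^bsub>alg\<^esub> \<in> carrier alg"
proof -
  show "u \<otimes>\<^bsub>alg\<^esub> v \<in> carrier alg" if "u \<in> carrier alg" "v \<in> carrier alg"
    by (rule alg_carrierI) (use that in \<open>simp_all add: alg_mult coeff_closed form_alg_closed\<close>)
qed (rule alg_carrierI; simp add: alg_add alg_smult alg_one alg_zero coeff_closed coeff_outside)+

text \<open>The \<open>V\<close>-part of \<open>u v\<close> is \<open>u\<^sub>0 v + v\<^sub>0 u\<close>, and \<open>\<beta>\<close> depends on nothing else. This is the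
identity behind associativity.\<close>

lemma form_mult:
  assumes "u \<in> carrier alg" "v \<in> carrier alg" "z \<in> carrier alg"
  shows "\<beta> k (u \<otimes>\<^bsub>alg\<^esub> v) z = u 0 \<otimes> \<beta> k v z \<oplus> v 0 \<otimes> \<beta> k u z"
  by (rule form_linear) (use assms alg_mult_closed in \<open>simp_all add: coeff_closed form_alg_closed alg_mult\<close>)

lemma alg_m_comm:
  assumes u: "u \<in> carrier alg" and v: "v \<in> carrier alg"
  shows "u \<otimes>\<^bsub>alg\<^esub> v = v \<otimes>\<^bsub>alg\<^esub> u"
proof
  fix k
  show "(u \<otimes>\<^bsub>alg\<^esub> v) k = (v \<otimes>\<^bsub>alg\<^esub> u) k"
    using form_alg_comm[OF u v] form_alg_closed[OF v u] coeff_closed[OF u] coeff_closed[OF v]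
    by (simp add: alg_mult m_comm[of "u 0" "v 0"] a_comm[of "u 0 \<otimes> v k"])
qed

text \<open>Only the \<open>W\<close>-part is of interest. There both bracketings give the symmetric expression
\<open>u\<^sub>0 v\<^sub>0 w + u\<^sub>0 w\<^sub>0 v + v\<^sub>0 w\<^sub>0 u + u\<^sub>0 \<beta>(v, w) + v\<^sub>0 \<beta>(u, w) + w\<^sub>0 \<beta>(u, v)\<close>.\<close>

lemma alg_m_assoc:
  assumes u: "u \<in> carrier alg" and v: "v \<in> carrier alg" and w: "w \<in> carrier alg"
  shows "u \<otimes>\<^bsub>alg\<^esub> v \<otimes>\<^bsub>alg\<^esub> w = u \<otimes>\<^bsub>alg\<^esub> (v \<otimes>\<^bsub>alg\<^esub> w)"
proof
  fix k
  note c = coeff_closed[OF u] coeff_closed[OF v] coeff_closed[OF w]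
  consider "k = 0" | "k \<noteq> 0" "k \<le> e" | "k > e" "k \<le> e + a" | "k > e + a" by linarith
  then show "(u \<otimes>\<^bsub>alg\<^esub> v \<otimes>\<^bsub>alg\<^esub> w) k = (u \<otimes>\<^bsub>alg\<^esub> (v \<otimes>\<^bsub>alg\<^esub> w)) k"
  proof cases
    case 3
    have b: "\<beta> k u v \<in> carrier K" "\<beta> k u w \<in> carrier K" "\<beta> k v w \<in> carrier K"
      using form_alg_closed u v w by auto
    have uvw: "\<beta> k (u \<otimes>\<^bsub>alg\<^esub> v) w = u 0 \<otimes> \<beta> k v w \<oplus> v 0 \<otimes> \<beta> k u w"
      by (rule form_mult[OF u v w])
    have "\<beta> k u (v \<otimes>\<^bsub>alg\<^esub> w) = \<beta> k (v \<otimes>\<^bsub>alg\<^esub> w) u"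
      by (rule form_alg_comm[OF u alg_mult_closed[OF v w]])
    also have "\<dots> = v 0 \<otimes> \<beta> k u w \<oplus> w 0 \<otimes> \<beta> k u v"
      using form_mult[OF v w u] form_alg_comm[OF w u] form_alg_comm[OF v u] by simp
    finally have vwu: "\<beta> k u (v \<otimes>\<^bsub>alg\<^esub> w) = v 0 \<otimes> \<beta> k u w \<oplus> w 0 \<otimes> \<beta> k u v" .
    have "(u \<otimes>\<^bsub>alg\<^esub> v \<otimes>\<^bsub>alg\<^esub> w) k = u 0 \<otimes> v 0 \<otimes> w k \<oplus> w 0 \<otimes> (u 0 \<otimes> v k \<oplus> v 0 \<otimes> u k \<oplus> \<beta> k u v)
        \<oplus> (u 0 \<otimes> \<beta> k v w \<oplus> v 0 \<otimes> \<beta> k u w)"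
      using 3 uvw by (simp add: alg_mult)
    also have "\<dots> = u 0 \<otimes> (v 0 \<otimes> w k \<oplus> w 0 \<otimes> v k \<oplus> \<beta> k v w) \<oplus> v 0 \<otimes> w 0 \<otimes> u k
        \<oplus> (v 0 \<otimes> \<beta> k u w \<oplus> w 0 \<otimes> \<beta> k u v)"
      using c[of 0] c[of k] b by (simp add: r_distr a_ac m_ac)
    also have "\<dots> = (u \<otimes>\<^bsub>alg\<^esub> (v \<otimes>\<^bsub>alg\<^esub> w)) k"
      using 3 vwu by (simp add: alg_mult)
    finally show ?thesis .
  qed (use c[of 0] c[of k] in \<open>simp_all add: alg_mult r_distr a_ac m_ac\<close>)
qed

lemma alg_cring: "cring alg"
proof (rule cringI)
  show "abelian_group alg"
  proof (rule abelian_groupI)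
    fix u assume u: "u \<in> carrier alg"
    show "\<exists>v\<in>carrier alg. v \<oplus>\<^bsub>alg\<^esub> u = \<zero>\<^bsub>alg\<^esub>"
    proof (rule bexI)
      show "(\<lambda>i. \<ominus> u i) \<oplus>\<^bsub>alg\<^esub> u = \<zero>\<^bsub>alg\<^esub>"
        using coeff_closed[OF u] by (auto simp: alg_add alg_zero l_neg)
      show "(\<lambda>i. \<ominus> u i) \<in> carrier alg"
        by (rule alg_carrierI) (use u in \<open>simp_all add: coeff_closed coeff_outside\<close>)
    qed
    show "\<zero>\<^bsub>alg\<^esub> \<oplus>\<^bsub>alg\<^esub> u = u" using coeff_closed[OF u] by (auto simp: alg_add alg_zero)
  next
    fix u v assume uv: "u \<in> carrier alg" "v \<in> carrier alg"
    show "u \<oplus>\<^bsub>alg\<^esub> v = v \<oplus>\<^bsub>alg\<^esub> u"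
      by (rule ext) (use uv in \<open>simp add: alg_add coeff_closed a_comm\<close>)
  next
    fix u v w assume uvw: "u \<in> carrier alg" "v \<in> carrier alg" "w \<in> carrier alg"
    show "u \<oplus>\<^bsub>alg\<^esub> v \<oplus>\<^bsub>alg\<^esub> w = u \<oplus>\<^bsub>alg\<^esub> (v \<oplus>\<^bsub>alg\<^esub> w)"
      by (rule ext) (use uvw in \<open>simp add: alg_add coeff_closed a_assoc\<close>)
  qed (rule alg_zero_closed alg_add_closed; assumption)+
  show "comm_monoid alg"
  proof (rule comm_monoidI)
    fix u assume u: "u \<in> carrier alg"
    have *: "\<beta> k \<one>\<^bsub>alg\<^esub> u = \<zero>" for k
      by (rule form_zero[OF alg_one_closed u]) (simp add: alg_one)
    show "\<one>\<^bsub>alg\<^esub> \<otimes>\<^bsub>alg\<^esub> u = u"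
    proof
      fix k show "(\<one>\<^bsub>alg\<^esub> \<otimes>\<^bsub>alg\<^esub> u) k = u k"
        using coeff_closed[OF u] coeff_outside[OF u] by (simp add: alg_mult alg_one *)
    qed
  qed (rule alg_mult_closed alg_one_closed alg_m_assoc alg_m_comm; assumption)+
  fix u v w assume u: "u \<in> carrier alg" and v: "v \<in> carrier alg" and w: "w \<in> carrier alg"
  note c = coeff_closed[OF u] coeff_closed[OF v] coeff_closed[OF w]
  show "(u \<oplus>\<^bsub>alg\<^esub> v) \<otimes>\<^bsub>alg\<^esub> w = u \<otimes>\<^bsub>alg\<^esub> w \<oplus>\<^bsub>alg\<^esub> v \<otimes>\<^bsub>alg\<^esub> w"
  proof
    fix k show "((u \<oplus>\<^bsub>alg\<^esub> v) \<otimes>\<^bsub>alg\<^esub> w) k = (u \<otimes>\<^bsub>alg\<^esub> w \<oplus>\<^bsub>alg\<^esub> v \<otimes>\<^bsub>alg\<^esub> w) k"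
      using c[of 0] c[of k] form_alg_closed[OF u w, of k] form_alg_closed[OF v w, of k]
      by (simp add: alg_add alg_mult form_add[OF u v w] l_distr r_distr a_ac)
  qed
qed

sublocale A: cring alg by (rule alg_cring)

lemma alg_module: "module K alg"
proof (rule moduleI[OF is_cring A.abelian_group_axioms])
qed (auto simp: alg_smult_closed alg_smult alg_add coeff_closed l_distr r_distr m_assoc)

text \<open>Scalars act through the ring, so \<open>alg\<close>-submodules are also \<open>k\<close>-subspaces.\<close>

lemma smult_one_mult:
  assumes c: "c \<in> carrier K" and u: "u \<in> carrier alg"
  shows "(c \<odot>\<^bsub>alg\<^esub> \<one>\<^bsub>alg\<^esub>) \<otimes>\<^bsub>alg\<^esub> u = c \<odot>\<^bsub>alg\<^esub> u"
proof
  fix k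
  have "\<beta> k (c \<odot>\<^bsub>alg\<^esub> \<one>\<^bsub>alg\<^esub>) u = \<zero>"
    by (rule form_zero) (use c u in \<open>simp_all add: alg_smult_closed alg_smult alg_one\<close>)
  then show "((c \<odot>\<^bsub>alg\<^esub> \<one>\<^bsub>alg\<^esub>) \<otimes>\<^bsub>alg\<^esub> u) k = (c \<odot>\<^bsub>alg\<^esub> u) k"
    using c coeff_closed[OF u] coeff_outside[OF u] by (simp add: alg_mult alg_one alg_smult)
qed

lemma alg_smult_mult:
  assumes "c \<in> carrier K" "u \<in> carrier alg" "v \<in> carrier alg"
  shows "(c \<odot>\<^bsub>alg\<^esub> u) \<otimes>\<^bsub>alg\<^esub> v = c \<odot>\<^bsub>alg\<^esub> (u \<otimes>\<^bsub>alg\<^esub> v)"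
  using assms smult_one_mult[of c u] smult_one_mult[of c "u \<otimes>\<^bsub>alg\<^esub> v"]
  by (metis A.m_assoc A.m_closed alg_one_closed alg_smult_closed)

lemma finsum_coeff:
  assumes "finite I" "f \<in> I \<rightarrow> carrier alg"
  shows "finsum alg f I k = (\<Oplus>i\<in>I. f i k)"
  using assms
proof (induction I rule: finite_induct)
  case (insert j I)
  have 1: "f j \<in> carrier alg" "f \<in> I \<rightarrow> carrier alg" using insert.prems by auto
  then have "(\<lambda>i. f i k) \<in> I \<rightarrow> carrier K" by (auto simp: coeff_closed Pi_iff)
  with 1 insert show ?case by (simp add: alg_add coeff_closed)
qed (simp add: alg_zero)

definition unit_vec :: "nat \<Rightarrow> nat \<Rightarrow> 'a" where
  "unit_vec i = (\<lambda>k. if k = i then \<one> else \<zero>)"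

lemma unit_vec_closed: "i \<le> e + a \<Longrightarrow> unit_vec i \<in> carrier alg"
  by (rule alg_carrierI) (auto simp: unit_vec_def)

lemma alg_unit_vec_expansion:
  assumes u: "u \<in> carrier alg"
  shows "u = (\<Oplus>\<^bsub>alg\<^esub>i\<in>{..e + a}. u i \<odot>\<^bsub>alg\<^esub> unit_vec i)"
proof
  fix k
  have closed: "(\<lambda>i. u i \<odot>\<^bsub>alg\<^esub> unit_vec i) \<in> {..e + a} \<rightarrow> carrier alg"
    using coeff_closed[OF u] by (auto intro: alg_smult_closed unit_vec_closed)
  have "(\<Oplus>\<^bsub>alg\<^esub>i\<in>{..e + a}. u i \<odot>\<^bsub>alg\<^esub> unit_vec i) k
      = (\<Oplus>i\<in>{..e + a}. (u i \<odot>\<^bsub>alg\<^esub> unit_vec i) k)"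
    by (rule finsum_coeff[OF _ closed]) simp
  also have "\<dots> = (\<Oplus>i\<in>{..e + a}. if k = i then u i else \<zero>)"
    by (rule finsum_cong') (use coeff_closed[OF u] in \<open>auto simp: alg_smult unit_vec_def\<close>)
  also have "\<dots> = u k"
  proof (cases "k \<le> e + a")
    case True
    then show ?thesis
      using coeff_closed[OF u] by (intro add.finprod_singleton) auto
  next
    case False
    then have "(\<Oplus>i\<in>{..e + a}. if k = i then u i else \<zero>) = (\<Oplus>i\<in>{..e + a}. \<zero>)"
      by (intro finsum_cong') auto
    then show ?thesis using False coeff_outside[OF u, of k] by simp
  qed
  finally show "u k = (\<Oplus>\<^bsub>alg\<^esub>i\<in>{..e + a}. u i \<odot>\<^bsub>alg\<^esub> unit_vec i) k" by simp
qed

lemma alg_fd_algebra: "fd_algebra K alg"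
proof (intro fd_algebra.intro fd_algebra_axioms.intro field_axioms A.ring_axioms alg_module)
  fix c u v assume *: "c \<in> carrier K" "u \<in> carrier alg" "v \<in> carrier alg"
  then show "(c \<odot>\<^bsub>alg\<^esub> u) \<otimes>\<^bsub>alg\<^esub> v = c \<odot>\<^bsub>alg\<^esub> (u \<otimes>\<^bsub>alg\<^esub> v)" by (rule alg_smult_mult)
  then show "u \<otimes>\<^bsub>alg\<^esub> (c \<odot>\<^bsub>alg\<^esub> v) = c \<odot>\<^bsub>alg\<^esub> (u \<otimes>\<^bsub>alg\<^esub> v)"
    using * alg_smult_mult[of c v u] by (simp add: A.m_comm alg_smult_closed)
next
  let ?B = "unit_vec ` {..e + a}"
  have inj: "inj_on unit_vec {..e + a}"
    by (rule inj_onI) (metis unit_vec_def one_not_zero)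
  have "\<exists>c\<in>?B \<rightarrow> carrier K. u = (\<Oplus>\<^bsub>alg\<^esub>b\<in>?B. c b \<odot>\<^bsub>alg\<^esub> b)" if u: "u \<in> carrier alg" for u
  proof (rule bexI)
    let ?c = "\<lambda>b. u (the_inv_into {..e + a} unit_vec b)"
    have "(\<Oplus>\<^bsub>alg\<^esub>b\<in>?B. ?c b \<odot>\<^bsub>alg\<^esub> b) = (\<Oplus>\<^bsub>alg\<^esub>i\<in>{..e + a}. ?c (unit_vec i) \<odot>\<^bsub>alg\<^esub> unit_vec i)"
      by (rule A.add.finprod_reindex[OF _ inj])
        (auto simp: coeff_closed[OF u] intro: alg_smult_closed unit_vec_closed)
    also have "\<dots> = (\<Oplus>\<^bsub>alg\<^esub>i\<in>{..e + a}. u i \<odot>\<^bsub>alg\<^esub> unit_vec i)"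
      by (rule A.finsum_cong')
        (auto simp: the_inv_into_f_f[OF inj] coeff_closed[OF u]
          intro: alg_smult_closed unit_vec_closed)
    also have "\<dots> = u" using alg_unit_vec_expansion[OF u] by simp
    finally show "u = (\<Oplus>\<^bsub>alg\<^esub>b\<in>?B. ?c b \<odot>\<^bsub>alg\<^esub> b)" by simp
    show "?c \<in> ?B \<rightarrow> carrier K" by (simp add: coeff_closed[OF u])
  qed
  moreover have "finite ?B" "?B \<subseteq> carrier alg" by (auto intro: unit_vec_closed)
  ultimately show "\<exists>B. finite B \<and> B \<subseteq> carrier alg \<and>
      (\<forall>u\<in>carrier alg. \<exists>c\<in>B \<rightarrow> carrier K. u = (\<Oplus>\<^bsub>alg\<^esub>b\<in>B. c b \<odot>\<^bsub>alg\<^esub> b))"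
    by blast
qed


section \<open>Coordinate ideals and the radical\<close>

definition coord_space :: "nat set \<Rightarrow> (nat \<Rightarrow> 'a) set" where
  "coord_space S = {u \<in> carrier alg. \<forall>i. i \<notin> S \<longrightarrow> u i = \<zero>}"

text \<open>A sufficient condition for \<open>coord_space S\<close> to be an ideal: it either contains \<open>W\<close>, so that all values
of \<open>\<beta>\<close> are allowed, or is contained in \<open>W\<close>, so that \<open>\<beta>\<close> vanishes on it. The subspace for
\<open>{0<..e + a}\<close> is \<open>V \<oplus> W\<close>, which will be the radical, and the one for \<open>{e<..e + a}\<close> is \<open>W\<close>.\<close>

definition ideal_support :: "nat set \<Rightarrow> bool" where
  "ideal_support S \<longleftrightarrow> S \<subseteq> {0<..e + a} \<and> ({e<..e + a} \<subseteq> S \<or> S \<subseteq> {e<..e + a})"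

lemma coord_space_subset: "coord_space S \<subseteq> carrier alg"
  by (auto simp: coord_space_def)

lemma coord_space_mono: "S \<subseteq> T \<Longrightarrow> coord_space S \<subseteq> coord_space T"
  by (auto simp: coord_space_def)

lemma coord_space_empty: "coord_space {} = {\<zero>\<^bsub>alg\<^esub>}"
  by (auto simp: coord_space_def alg_zero)

lemma unit_vec_coord_space: "\<lbrakk>i \<in> S; i \<le> e + a\<rbrakk> \<Longrightarrow> unit_vec i \<in> coord_space S"
  using unit_vec_closed[of i] by (auto simp: coord_space_def unit_vec_def)

lemma ideal_coord_space:
  assumes S: "ideal_support S"
  shows "ideal (coord_space S) alg"
proof -
  interpret M: module alg "regular_module alg" by (rule A.module_regular_module)
  have "submodule (coord_space S) alg (regular_module alg)"
  proof (rule M.submoduleI_closed)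
    fix u v assume "u \<in> carrier alg" and v: "v \<in> coord_space S"
    then have u: "u \<in> carrier alg" and v': "v \<in> carrier alg" "\<And>i. i \<notin> S \<Longrightarrow> v i = \<zero>"
      by (auto simp: coord_space_def)
    have S0: "0 \<notin> S" using S by (auto simp: ideal_support_def)
    have form: "\<beta> k u v = \<zero>" if "e < k" "k \<le> e + a" "k \<notin> S" for k
    proof -
      have "k \<in> {e<..e + a}" using that by simp
      then have "S \<subseteq> {e<..e + a}" using S \<open>k \<notin> S\<close> unfolding ideal_support_def by blast
      then have "i \<notin> S" if "i \<le> e" for i using that by auto
      then have "v i = \<zero>" if "i \<le> e" for i using v'(2) that by blast
      then show ?thesis using form_zero[OF v'(1) u] form_alg_comm[OF u v'(1)] by simp
    qed
    have "(u \<otimes>\<^bsub>alg\<^esub> v) k = \<zero>" if "k \<notin> S" for k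
      using that form[of k] v'(2)[of k] v'(2)[OF S0] coeff_closed[OF u] by (simp add: alg_mult)
    then show "u \<odot>\<^bsub>regular_module alg\<^esub> v \<in> coord_space S"
      using u v' by (simp add: coord_space_def alg_mult_closed)
  qed (auto simp: coord_space_def alg_zero alg_add alg_add_closed)
  then show ?thesis by (simp add: A.submodule_regular_iff_ideal)
qed

lemma ideal_support_radical: "ideal_support {0<..e + a}"
  by (auto simp: ideal_support_def)

lemma ideal_support_top: "ideal_support {e<..e + a}"
  by (auto simp: ideal_support_def)

lemma radical_coord_space_iff: "u \<in> coord_space {0<..e + a} \<longleftrightarrow> u \<in> carrier alg \<and> u 0 = \<zero>"
  using coeff_outside[of u] by (auto simp: coord_space_def)

text \<open>The coordinates of the inverse can be solved for in the order
\<open>k\<close>, \<open>V\<close>, \<open>W\<close>, since \<open>\<beta>\<close> uses only the part in \<open>V\<close> that is already known.\<close>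

lemma left_inverse:
  assumes u: "u \<in> carrier alg" and u0: "u 0 \<noteq> \<zero>"
  shows "\<exists>v\<in>carrier alg. v \<otimes>\<^bsub>alg\<^esub> u = \<one>\<^bsub>alg\<^esub>"
proof -
  define c where "c = inv (u 0)"
  have U: "u 0 \<in> Units K" using u0 coeff_closed[OF u] by (simp add: field_Units)
  have c: "c \<in> carrier K" "c \<otimes> u 0 = \<one>"
    using U by (simp_all add: c_def)
  have uc: "u k \<in> carrier K" for k by (rule coeff_closed[OF u])
  define v where "v = (\<lambda>k. if k = 0 then c
      else if k \<le> e then \<ominus> (c \<otimes> c) \<otimes> u k
      else if k \<le> e + a then \<ominus> c \<otimes> (c \<otimes> u k \<oplus> \<ominus> (c \<otimes> c) \<otimes> \<beta> k u u)
      else \<zero>)"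
  have v: "v \<in> carrier alg"
    by (rule alg_carrierI) (use c uc form_alg_closed[OF u u] in \<open>simp_all add: v_def\<close>)
  have form: "\<beta> k v u = \<ominus> (c \<otimes> c) \<otimes> \<beta> k u u" for k
  proof -
    have "\<beta> k v u = \<ominus> (c \<otimes> c) \<otimes> \<beta> k u u \<oplus> \<zero> \<otimes> \<beta> k u u"
      by (rule form_linear) (use c uc coeff_closed[OF v] in \<open>simp_all add: v_def\<close>)
    then show ?thesis using c form_alg_closed[OF u u] by simp
  qed
  have cancel: "u 0 \<otimes> (\<ominus> c \<otimes> y) = \<ominus> y" if "y \<in> carrier K" for y
  proof -
    have "u 0 \<otimes> (\<ominus> c \<otimes> y) = \<ominus> (c \<otimes> u 0 \<otimes> y)"
      using that c(1) uc[of 0] by algebra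
    then show ?thesis using that c(2) by simp
  qed
  have "v \<otimes>\<^bsub>alg\<^esub> u = \<one>\<^bsub>alg\<^esub>"
  proof
    fix k
    consider "k = 0" | "k \<noteq> 0" "k \<le> e" | "k > e" "k \<le> e + a" | "k > e + a" by linarith
    then show "(v \<otimes>\<^bsub>alg\<^esub> u) k = \<one>\<^bsub>alg\<^esub> k"
    proof cases
      case 1
      then show ?thesis using c by (simp add: alg_mult alg_one v_def)
    next
      case 2
      have "\<ominus> (c \<otimes> c) \<otimes> u k = \<ominus> c \<otimes> (c \<otimes> u k)" using c uc[of k] by algebra
      then have "u 0 \<otimes> v k = \<ominus> (c \<otimes> u k)"
        using 2 cancel[of "c \<otimes> u k"] c uc[of k] by (simp add: v_def)
      then show ?thesis
        using 2 c uc[of k] by (simp add: alg_mult alg_one r_neg) (simp add: v_def r_neg)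
    next
      case 3
      let ?y = "c \<otimes> u k \<oplus> \<ominus> (c \<otimes> c) \<otimes> \<beta> k u u"
      have b: "\<beta> k u u \<in> carrier K" by (rule form_alg_closed[OF u u])
      have y: "?y \<in> carrier K" using c uc b by simp
      have "v k = \<ominus> c \<otimes> ?y" using 3 by (simp add: v_def)
      then have *: "u 0 \<otimes> v k = \<ominus> ?y" using cancel[OF y] by simp
      have "(v \<otimes>\<^bsub>alg\<^esub> u) k = c \<otimes> u k \<oplus> \<ominus> ?y \<oplus> \<ominus> (c \<otimes> c) \<otimes> \<beta> k u u"
        unfolding alg_mult using 3 * form by (simp add: v_def)
      also have "\<dots> = \<zero>" using c(1) uc[of k] b by algebra
      finally show ?thesis using 3 by (simp add: alg_one)
    next
      case 4
      then show ?thesis by (simp add: alg_mult alg_one)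
    qed
  qed
  then show ?thesis using v by blast
qed

lemma proper_left_ideal_subset:
  assumes N: "submodule N alg (regular_module alg)"
  shows "N \<subseteq> coord_space {0<..e + a} \<or> N = carrier alg"
proof (rule disjCI)
  interpret N: ideal N alg using N by (simp add: A.submodule_regular_iff_ideal)
  assume "N \<noteq> carrier alg"
  then have "\<one>\<^bsub>alg\<^esub> \<notin> N" using N.one_imp_carrier by blast
  then have "u 0 = \<zero>" if "u \<in> N" for u
    using that left_inverse[of u] N.I_l_closed N.Icarr by metis
  then show "N \<subseteq> coord_space {0<..e + a}"
    using N.Icarr by (auto simp: radical_coord_space_iff)
qed

lemma maximal_left_ideal_iff: "maximal_left_ideal L alg \<longleftrightarrow> L = coord_space {0<..e + a}"
proof -
  let ?J = "coord_space {0<..e + a}"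
  have J: "submodule ?J alg (regular_module alg)"
    using ideal_coord_space[OF ideal_support_radical] by (simp add: A.submodule_regular_iff_ideal)
  have "\<one>\<^bsub>alg\<^esub> \<notin> ?J" by (simp add: radical_coord_space_iff alg_one)
  then have ne: "?J \<noteq> carrier alg" using alg_one_closed by blast
  show ?thesis
  proof
    assume L: "maximal_left_ideal L alg"
    then have sub: "submodule L alg (regular_module alg)" and "L \<noteq> carrier alg"
      by (simp_all add: maximal_left_ideal_def)
    then have "L \<subseteq> ?J" using proper_left_ideal_subset by blast
    then show "L = ?J" using L J ne unfolding maximal_left_ideal_def by blast
  next
    assume "L = ?J"
    moreover have "maximal_left_ideal ?J alg"
      unfolding maximal_left_ideal_def using J ne proper_left_ideal_subset by blast
    ultimately show "maximal_left_ideal L alg" by simp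
  qed
qed

lemma radical_alg: "radical alg = coord_space {0<..e + a}"
  using coord_space_subset by (auto simp: radical_def maximal_left_ideal_iff)

text \<open>Two elements are congruent modulo the radical iff their coordinates at \<open>0\<close> agree, so the multiples of
the unit represent each class exactly once.\<close>

lemma alg_local_algebra: "local_algebra K alg"
proof -
  let ?J = "coord_space {0<..e + a}"
  let ?h = "\<lambda>c. ?J +>\<^bsub>alg\<^esub> (c \<odot>\<^bsub>alg\<^esub> \<one>\<^bsub>alg\<^esub>)"
  interpret J: ideal ?J alg by (rule ideal_coord_space[OF ideal_support_radical])
  have s: "c \<odot>\<^bsub>alg\<^esub> \<one>\<^bsub>alg\<^esub> \<in> carrier alg" if "c \<in> carrier K" for c
    using that by (simp add: alg_smult_closed)
  have coset_eq: "?J +>\<^bsub>alg\<^esub> u = ?J +>\<^bsub>alg\<^esub> v \<longleftrightarrow> u 0 = v 0"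
    if u: "u \<in> carrier alg" and v: "v \<in> carrier alg" for u v
  proof -
    have "u \<ominus>\<^bsub>alg\<^esub> v \<oplus>\<^bsub>alg\<^esub> v = u" using u v by algebra
    then have "u 0 = (u \<ominus>\<^bsub>alg\<^esub> v) 0 \<oplus> v 0" by (metis alg_add)
    then have "(u \<ominus>\<^bsub>alg\<^esub> v) 0 = \<zero> \<longleftrightarrow> u 0 = v 0"
      using coeff_closed[OF v] coeff_closed[OF A.minus_closed[OF u v]]
      by (metis add.r_cancel_one')
    then have "u \<in> ?J +>\<^bsub>alg\<^esub> v \<longleftrightarrow> u 0 = v 0"
      using u v J.a_rcos_module_minus[OF A.ring_axioms v u] by (simp add: radical_coord_space_iff)
    then show ?thesis
      using J.a_repr_independence'[OF _ v] J.a_rcos_self[OF u] by metis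
  qed
  have "?h \<in> ring_iso K (alg Quot ?J)"
  proof (rule ring_iso_memI)
    fix c d assume c: "c \<in> carrier K" and d: "d \<in> carrier K"
    show "?h c \<in> carrier (alg Quot ?J)"
      using s[OF c] by (auto simp: FactRing_def A_RCOSETS_def')
    have "(c \<otimes> d) \<odot>\<^bsub>alg\<^esub> \<one>\<^bsub>alg\<^esub> = (c \<odot>\<^bsub>alg\<^esub> \<one>\<^bsub>alg\<^esub>) \<otimes>\<^bsub>alg\<^esub> (d \<odot>\<^bsub>alg\<^esub> \<one>\<^bsub>alg\<^esub>)"
      by (subst smult_one_mult[OF c s[OF d]])
        (use c d in \<open>auto simp: alg_smult alg_one m_assoc\<close>)
    then show "?h (c \<otimes> d) = ?h c \<otimes>\<^bsub>alg Quot ?J\<^esub> ?h d"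
      using s[OF c] s[OF d] by (simp add: FactRing_def J.rcoset_mult_add)
    have "(c \<oplus> d) \<odot>\<^bsub>alg\<^esub> \<one>\<^bsub>alg\<^esub> = (c \<odot>\<^bsub>alg\<^esub> \<one>\<^bsub>alg\<^esub>) \<oplus>\<^bsub>alg\<^esub> (d \<odot>\<^bsub>alg\<^esub> \<one>\<^bsub>alg\<^esub>)"
      using c d by (auto simp: alg_add alg_smult alg_one)
    then show "?h (c \<oplus> d) = ?h c \<oplus>\<^bsub>alg Quot ?J\<^esub> ?h d"
      using s[OF c] s[OF d] by (simp add: FactRing_def J.a_rcos_sum)
  next
    have "\<one> \<odot>\<^bsub>alg\<^esub> \<one>\<^bsub>alg\<^esub> = \<one>\<^bsub>alg\<^esub>" by (auto simp: alg_smult alg_one)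
    then show "?h \<one> = \<one>\<^bsub>alg Quot ?J\<^esub>" by (simp add: FactRing_def)
  next
    show "bij_betw ?h (carrier K) (carrier (alg Quot ?J))"
    proof (rule bij_betw_imageI)
      show "inj_on ?h (carrier K)"
        by (rule inj_onI) (simp add: coset_eq s, simp add: alg_smult alg_one)
      show "?h ` carrier K = carrier (alg Quot ?J)"
      proof
        show "?h ` carrier K \<subseteq> carrier (alg Quot ?J)"
          using s by (auto simp: FactRing_def A_RCOSETS_def')
        show "carrier (alg Quot ?J) \<subseteq> ?h ` carrier K"
        proof
          fix X assume "X \<in> carrier (alg Quot ?J)"
          then obtain u where u: "u \<in> carrier alg" "X = ?J +>\<^bsub>alg\<^esub> u"
            by (auto simp: FactRing_def A_RCOSETS_def')
          have "X = ?h (u 0)"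
            unfolding u(2) using u(1) coeff_closed[OF u(1)]
            by (subst coset_eq) (simp_all add: s, simp add: alg_smult alg_one)
          then show "X \<in> ?h ` carrier K" using coeff_closed[OF u(1)] by blast
        qed
      qed
    qed
  qed
  moreover have "local_ring alg" unfolding local_ring_def by (simp add: maximal_left_ideal_iff)
  ultimately show ?thesis unfolding local_algebra_def radical_alg using alg_fd_algebra by blast
qed

lemma mult_radical_radical:
  assumes u: "u \<in> coord_space {0<..e + a}" and v: "v \<in> coord_space {0<..e + a}"
  shows "u \<otimes>\<^bsub>alg\<^esub> v \<in> coord_space {e<..e + a}"
proof -
  have *: "u \<in> carrier alg" "v \<in> carrier alg" "u 0 = \<zero>" "v 0 = \<zero>"
    using u v by (simp_all add: radical_coord_space_iff)
  have "(u \<otimes>\<^bsub>alg\<^esub> v) k = \<zero>" if "k \<notin> {e<..e + a}" for k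
    using * that coeff_closed[OF *(1), of k] coeff_closed[OF *(2), of k] by (auto simp: alg_mult)
  then show ?thesis using * by (simp add: coord_space_def alg_mult_closed)
qed

lemma mult_square_radical:
  assumes u: "u \<in> coord_space {e<..e + a}" and v: "v \<in> coord_space {0<..e + a}"
  shows "u \<otimes>\<^bsub>alg\<^esub> v = \<zero>\<^bsub>alg\<^esub>"
proof
  fix k
  have *: "u \<in> carrier alg" "v \<in> carrier alg" "u 0 = \<zero>" "v 0 = \<zero>" "\<And>i. i \<le> e \<Longrightarrow> u i = \<zero>"
    using u v by (auto simp: radical_coord_space_iff) (auto simp: coord_space_def)
  have "\<beta> k u v = \<zero>" by (rule form_zero) (use * in auto)
  then show "(u \<otimes>\<^bsub>alg\<^esub> v) k = \<zero>\<^bsub>alg\<^esub> k"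
    using * coeff_closed[OF *(1), of k] coeff_closed[OF *(2), of k]
    by (simp add: alg_mult alg_zero)
qed

lemma square_radical_subset:
  "coord_space {0<..e + a} \<cdot>\<^bsub>alg\<^esub> coord_space {0<..e + a} \<subseteq> coord_space {e<..e + a}"
proof
  interpret W: ideal "coord_space {e<..e + a}" alg
    by (rule ideal_coord_space[OF ideal_support_top])
  fix u assume "u \<in> coord_space {0<..e + a} \<cdot>\<^bsub>alg\<^esub> coord_space {0<..e + a}"
  then show "u \<in> coord_space {e<..e + a}"
    by induction (auto intro: mult_radical_radical)
qed

lemma alg_short_local_algebra: "short_local_algebra K alg"
proof -
  let ?J = "coord_space {0<..e + a}"
  have "u = \<zero>\<^bsub>alg\<^esub>" if "u \<in> (?J \<cdot>\<^bsub>alg\<^esub> ?J) \<cdot>\<^bsub>alg\<^esub> ?J" for u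
    using that
  proof induction
    case (prod i j)
    then show ?case using square_radical_subset mult_square_radical by blast
  qed auto
  moreover have "\<zero>\<^bsub>alg\<^esub> \<in> (?J \<cdot>\<^bsub>alg\<^esub> ?J) \<cdot>\<^bsub>alg\<^esub> ?J"
  proof -
    have z: "\<zero>\<^bsub>alg\<^esub> \<in> ?J" by (simp add: radical_coord_space_iff alg_zero)
    have "\<zero>\<^bsub>alg\<^esub> \<otimes>\<^bsub>alg\<^esub> \<zero>\<^bsub>alg\<^esub> \<otimes>\<^bsub>alg\<^esub> \<zero>\<^bsub>alg\<^esub> \<in> (?J \<cdot>\<^bsub>alg\<^esub> ?J) \<cdot>\<^bsub>alg\<^esub> ?J"
      by (intro ideal_prod.prod z)
    then show ?thesis by simp
  qed
  ultimately show ?thesis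
    unfolding short_local_algebra_def radical_alg using alg_local_algebra by blast
qed

text \<open>Coordinate subspaces that differ by one position differ by one dimension: an element of \<open>N\<close> with
nonzero coordinate at \<open>s\<close> can be scaled to clear the coordinate at \<open>s\<close> of any given vector.\<close>

lemma coord_space_insert_simple:
  assumes s: "s \<notin> S" "s \<le> e + a"
    and N: "coord_space S \<subset> N" "N \<subseteq> coord_space (insert s S)"
    and add: "\<And>u v. \<lbrakk>u \<in> N; v \<in> N\<rbrakk> \<Longrightarrow> u \<oplus>\<^bsub>alg\<^esub> v \<in> N"
    and smult: "\<And>c u. \<lbrakk>c \<in> carrier K; u \<in> N\<rbrakk> \<Longrightarrow> c \<odot>\<^bsub>alg\<^esub> u \<in> N"
  shows "coord_space (insert s S) \<subseteq> N"
proof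
  obtain u where u: "u \<in> N" "u \<notin> coord_space S" using N(1) by blast
  then have uA: "u \<in> carrier alg" and u_out: "\<And>i. i \<notin> insert s S \<Longrightarrow> u i = \<zero>"
    using N(2) by (auto simp: coord_space_def)
  have us: "u s \<noteq> \<zero>"
    using u(2) uA u_out by (auto simp: coord_space_def) metis
  have U: "u s \<in> Units K" using us coeff_closed[OF uA] by (simp add: field_Units)
  fix w assume w: "w \<in> coord_space (insert s S)"
  then have wA: "w \<in> carrier alg" and w_out: "\<And>i. i \<notin> insert s S \<Longrightarrow> w i = \<zero>"
    by (auto simp: coord_space_def)
  define c where "c = w s \<otimes> inv (u s)"
  have c: "c \<in> carrier K" "c \<otimes> u s = w s"
    using U coeff_closed[OF wA] coeff_closed[OF uA] by (simp_all add: c_def m_assoc)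
  define r where "r = (\<lambda>i. w i \<ominus> c \<otimes> u i)"
  have r: "r \<in> coord_space S"
    unfolding coord_space_def
  proof (intro CollectI conjI allI impI alg_carrierI)
    show "r i \<in> carrier K" for i
      using c coeff_closed[OF wA] coeff_closed[OF uA] by (simp add: r_def)
    show "r i = \<zero>" if "i > e + a" for i
      using that c coeff_outside[OF wA, of i] coeff_outside[OF uA, of i]
      by (simp add: r_def a_minus_def)
    show "r i = \<zero>" if "i \<notin> S" for i
    proof (cases "i = s")
      case True
      then show ?thesis using c coeff_closed[OF wA, of s] by (simp add: r_def a_minus_def r_neg)
    next
      case False
      then show ?thesis using that c w_out[of i] u_out[of i] by (simp add: r_def a_minus_def)
    qed
  qed
  have "w = r \<oplus>\<^bsub>alg\<^esub> (c \<odot>\<^bsub>alg\<^esub> u)"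
  proof
    fix i
    have "w i = w i \<ominus> c \<otimes> u i \<oplus> c \<otimes> u i"
      using c(1) coeff_closed[OF wA, of i] coeff_closed[OF uA, of i] by algebra
    then show "w i = (r \<oplus>\<^bsub>alg\<^esub> (c \<odot>\<^bsub>alg\<^esub> u)) i" by (simp add: alg_add alg_smult r_def)
  qed
  then show "w \<in> N" using add smult[OF c(1) u(1)] r N(1) by blast
qed

text \<open>All lengths in the theorem are computed by adding the positions \<open>s 0, s 1, ...\<close> one at a time to a
starting set \<open>S\<close>.\<close>

lemma coord_space_composition_chain:
  assumes inj: "inj_on s {..<m}" and disj: "s ` {..<m} \<inter> S = {}"
    and support: "\<And>i. i \<le> m \<Longrightarrow> ideal_support (S \<union> s ` {..<i})"
  shows "composition_chain alg ((regular_module alg)\<lparr>carrier := coord_space (S \<union> s ` {..<m})\<rparr>)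
    (\<lambda>i. coord_space (S \<union> s ` {..<i})) m"
proof -
  let ?D = "\<lambda>i. coord_space (S \<union> s ` {..<i})"
  let ?M = "(regular_module alg)\<lparr>carrier := ?D m\<rparr>"
  have ideal: "ideal (?D i) alg" if "i \<le> m" for i using ideal_coord_space[OF support[OF that]] .
  interpret M: module alg ?M using A.module_ideal[OF ideal[of m]] by simp
  have sub: "submodule (?D i) alg ?M" if "i \<le> m" for i
    by (rule A.submodule_ideal[OF ideal[OF that] ideal coord_space_mono]) (use that in auto)
  have Suc: "S \<union> s ` {..<Suc i} = insert (s i) (S \<union> s ` {..<i})" for i
    by (auto simp: lessThan_Suc)
  have new: "s i \<notin> S \<union> s ` {..<i}" if "i < m" for i
  proof -
    have "s i \<noteq> s j" if "j < i" for j
      using inj_onD[OF inj, of i j] \<open>i < m\<close> that by auto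
    then show ?thesis using disj \<open>i < m\<close> by auto
  qed
  have bound: "s i \<le> e + a" if "i < m" for i
    using support[of "Suc i"] that by (auto simp: ideal_support_def)
  show ?thesis
    unfolding composition_chain_def
  proof (intro conjI allI impI)
    show "submodule (?D i) alg ?M" if "i \<le> m" for i using sub[OF that] .
  next
    fix i assume i: "i < m"
    have "unit_vec (s i) \<in> ?D (Suc i)"
      by (rule unit_vec_coord_space) (use bound[OF i] in auto)
    moreover have "unit_vec (s i) \<notin> ?D i"
      using new[OF i] unfolding coord_space_def unit_vec_def by simp
    moreover have "?D i \<subseteq> ?D (Suc i)" by (rule coord_space_mono) auto
    ultimately show "?D i \<subset> ?D (Suc i)" by blast
    show "\<not> (\<exists>N. submodule N alg ?M \<and> ?D i \<subset> N \<and> N \<subset> ?D (Suc i))"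
    proof
      assume "\<exists>N. submodule N alg ?M \<and> ?D i \<subset> N \<and> N \<subset> ?D (Suc i)"
      then obtain N where N: "submodule N alg ?M" "?D i \<subset> N" "N \<subset> ?D (Suc i)" by iprover
      have "?D (Suc i) \<subseteq> N"
        unfolding Suc
      proof (rule coord_space_insert_simple[OF new[OF i] bound[OF i] N(2)])
        show "N \<subseteq> coord_space (insert (s i) (S \<union> s ` {..<i}))" using N(3) unfolding Suc by blast
        show "u \<oplus>\<^bsub>alg\<^esub> v \<in> N" if "u \<in> N" "v \<in> N" for u v
          using M.submoduleE(5)[OF N(1)] that by simp
        show "c \<odot>\<^bsub>alg\<^esub> u \<in> N" if c: "c \<in> carrier K" and u: "u \<in> N" for c u
        proof -
          have "u \<in> carrier alg" using u N(3) coord_space_subset by blast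
          then have "c \<odot>\<^bsub>alg\<^esub> u = (c \<odot>\<^bsub>alg\<^esub> \<one>\<^bsub>alg\<^esub>) \<otimes>\<^bsub>alg\<^esub> u" using smult_one_mult[OF c] by simp
          then show ?thesis
            using M.submoduleE(4)[OF N(1) alg_smult_closed[OF c alg_one_closed] u] by simp
        qed
      qed
      then show False using N(3) by blast
    qed
  qed
qed

end

section \<open>The example\<close>

text \<open>The basis of \<open>V\<close> consists of \<open>x\<close> (position \<open>1\<close>), of \<open>y\<^sub>1, ..., y\<^sub>a\<close> (positions \<open>2, ..., a + 1\<close>) and of
\<open>e - 1 - a\<close> further vectors \<open>z\<close> (positions \<open>a + 2, ..., e\<close>); the basis \<open>w\<^sub>1, ..., w\<^sub>a\<close> of \<open>W\<close> has the
positions \<open>e + 1, ..., e + a\<close>.\<close>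

locale reflexive_example = field K for K (structure) +
  fixes e a :: nat
  assumes a_pos: "1 \<le> a" and a_less: "a < e"
begin

text \<open>The nonzero products of basis vectors are \<open>x y\<^sub>i = w\<^sub>i\<close> and \<open>z\<^sup>2 = w\<^sub>1\<close> for each of the vectors \<open>z\<close>. At
position \<open>k = e + i\<close> of \<open>w\<^sub>i\<close>, the position of \<open>y\<^sub>i\<close> is \<open>i + 1 = Suc (k - e)\<close>.\<close>

definition form :: "nat \<Rightarrow> (nat \<Rightarrow> 'a) \<Rightarrow> (nat \<Rightarrow> 'a) \<Rightarrow> 'a" where
  "form k u v = (if e < k \<and> k \<le> e + a
     then u 1 \<otimes> v (Suc (k - e)) \<oplus> u (Suc (k - e)) \<otimes> v 1
       \<oplus> (if k = Suc e then \<Oplus>i\<in>{a + 2..e}. u i \<otimes> v i else \<zero>)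
     else \<zero>)"

sublocale bilinear_local_algebra K e a form
proof
  fix u v :: "nat \<Rightarrow> 'a" and k
  assume u: "\<And>i. u i \<in> carrier K" and v: "\<And>i. v i \<in> carrier K"
  show "form k u v \<in> carrier K"
    using u v by (simp add: form_def finsum_closed)
  have "(\<Oplus>i\<in>{a + 2..e}. u i \<otimes> v i) = (\<Oplus>i\<in>{a + 2..e}. v i \<otimes> u i)"
    by (rule finsum_cong') (use u v in \<open>auto simp: m_comm\<close>)
  then show "form k u v = form k v u"
    using u v by (simp add: form_def m_comm a_comm)
next
  fix u v w z :: "nat \<Rightarrow> 'a" and c d k
  assume u: "\<And>i. u i \<in> carrier K" and v: "\<And>i. v i \<in> carrier K" and w: "\<And>i. w i \<in> carrier K"
    and z: "\<And>i. z i \<in> carrier K" and c: "c \<in> carrier K" and d: "d \<in> carrier K"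
    and lin: "\<And>i. \<lbrakk>1 \<le> i; i \<le> e\<rbrakk> \<Longrightarrow> w i = c \<otimes> u i \<oplus> d \<otimes> v i"
  let ?s = "\<lambda>u. \<Oplus>i\<in>{a + 2..e}. u i \<otimes> z i"
  have s: "?s u \<in> carrier K" "?s v \<in> carrier K"
    using u v z by (auto intro: finsum_closed)
  have "?s w = (\<Oplus>i\<in>{a + 2..e}. c \<otimes> (u i \<otimes> z i) \<oplus> d \<otimes> (v i \<otimes> z i))"
    by (rule finsum_cong') (use u v z c d lin in \<open>auto simp: l_distr m_assoc\<close>)
  also have "\<dots> = (\<Oplus>i\<in>{a + 2..e}. c \<otimes> (u i \<otimes> z i)) \<oplus> (\<Oplus>i\<in>{a + 2..e}. d \<otimes> (v i \<otimes> z i))"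
    by (rule finsum_addf) (use u v z c d in auto)
  also have "\<dots> = c \<otimes> ?s u \<oplus> d \<otimes> ?s v"
    using u v z c d by (simp add: finsum_rdistr)
  finally have sum: "?s w = c \<otimes> ?s u \<oplus> d \<otimes> ?s v" .
  show "form k w z = c \<otimes> form k u z \<oplus> d \<otimes> form k v z"
  proof (cases "e < k \<and> k \<le> e + a")
    case True
    then have lin': "w 1 = c \<otimes> u 1 \<oplus> d \<otimes> v 1"
        "w (Suc (k - e)) = c \<otimes> u (Suc (k - e)) \<oplus> d \<otimes> v (Suc (k - e))"
      using a_less by (auto intro!: lin)
    have eq: "form k t z = t 1 \<otimes> z (Suc (k - e)) \<oplus> t (Suc (k - e)) \<otimes> z 1
        \<oplus> (if k = Suc e then ?s t else \<zero>)" for t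
      using True unfolding form_def by simp
    show ?thesis
      unfolding eq sum lin'
      using u[of 1] u[of "Suc (k - e)"] v[of 1] v[of "Suc (k - e)"] z[of 1] z[of "Suc (k - e)"] c d s
      by (simp add: l_distr r_distr a_ac m_ac)
  next
    case False
    then have "form k t z = \<zero>" for t unfolding form_def by (rule if_not_P)
    then show ?thesis using c d by simp
  qed
qed

definition x :: "nat \<Rightarrow> 'a" where
  "x = unit_vec 1"

lemma x_closed: "x \<in> carrier alg"
  unfolding x_def by (rule unit_vec_closed) (use a_less in simp)

lemma mult_x:
  assumes u: "u \<in> carrier alg"
  shows "(u \<otimes>\<^bsub>alg\<^esub> x) k = (if k = 1 then u 0
    else if e < k \<and> k \<le> e + a then u (Suc (k - e)) else \<zero>)"
proof -
  have "(\<Oplus>i\<in>{a + 2..e}. u i \<otimes> x i) = (\<Oplus>i\<in>{a + 2..e}. \<zero>)"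
    by (rule finsum_cong') (use coeff_closed[OF u] in \<open>auto simp: x_def unit_vec_def\<close>)
  then have "(\<Oplus>i\<in>{a + 2..e}. u i \<otimes> x i) = \<zero>" by simp
  then show ?thesis
    using coeff_closed[OF u] a_less a_pos
    by (auto simp: alg_mult form_def x_def unit_vec_def)
qed

text \<open>The product \<open>(c + y) x\<close> with \<open>y\<close> in the span of the \<open>y\<^sub>i\<close> is \<open>c x\<close> plus the copy of \<open>y\<close> in \<open>W\<close>, so \<open>r\<close> is
read off from the coordinates of \<open>v\<close>. If \<open>v\<close> has no component along \<open>x\<close>, this quotient lies in the
radical; hence \<open>W = J x\<close>.\<close>

lemma mult_x_quotient:
  assumes v: "v \<in> coord_space (insert 1 {e<..e + a})"
  shows "\<exists>r\<in>carrier alg. r 0 = v 1 \<and> v = r \<otimes>\<^bsub>alg\<^esub> x"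
proof (intro bexI conjI)
  define r where "r = (\<lambda>k. if k = 0 then v 1 else if 2 \<le> k \<and> k \<le> a + 1 then v (e + k - 1) else \<zero>)"
  have vA: "v \<in> carrier alg" using v by (simp add: coord_space_def)
  show r: "r \<in> carrier alg"
    by (rule alg_carrierI) (use coeff_closed[OF vA] a_less in \<open>auto simp: r_def\<close>)
  show "r 0 = v 1" by (simp add: r_def)
  show "v = r \<otimes>\<^bsub>alg\<^esub> x"
    using v by (intro ext) (auto simp: mult_x[OF r] coord_space_def, auto simp: r_def)
qed

lemma PIdl_x: "PIdl\<^bsub>alg\<^esub> x = coord_space (insert 1 {e<..e + a})"
proof
  show "PIdl\<^bsub>alg\<^esub> x \<subseteq> coord_space (insert 1 {e<..e + a})"
    by (auto simp: cgenideal_def coord_space_def mult_x x_closed alg_mult_closed)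
  show "coord_space (insert 1 {e<..e + a}) \<subseteq> PIdl\<^bsub>alg\<^esub> x"
    unfolding cgenideal_def using mult_x_quotient by blast
qed

lemma top_eq_radical_mult_x:
  assumes v: "v \<in> coord_space {e<..e + a}"
  shows "\<exists>r\<in>coord_space {0<..e + a}. v = r \<otimes>\<^bsub>alg\<^esub> x"
proof -
  have "v \<in> coord_space (insert 1 {e<..e + a})"
    using v coord_space_mono[of "{e<..e + a}" "insert 1 {e<..e + a}"] by blast
  then obtain r where "r \<in> carrier alg" "r 0 = v 1" "v = r \<otimes>\<^bsub>alg\<^esub> x"
    using mult_x_quotient by blast
  moreover have "v 1 = \<zero>" using v a_less a_pos by (auto simp: coord_space_def)
  ultimately show ?thesis by (metis radical_coord_space_iff)
qed

lemma x_in_radical: "x \<in> coord_space {0<..e + a}"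
  by (simp add: radical_coord_space_iff x_closed) (simp add: x_def unit_vec_def)

lemma square_radical: "coord_space {0<..e + a} \<cdot>\<^bsub>alg\<^esub> coord_space {0<..e + a} = coord_space {e<..e + a}"
proof
  show "coord_space {e<..e + a} \<subseteq> coord_space {0<..e + a} \<cdot>\<^bsub>alg\<^esub> coord_space {0<..e + a}"
    using top_eq_radical_mult_x x_in_radical by (metis ideal_prod.prod subsetI)
qed (rule square_radical_subset)

text \<open>The annihilator of \<open>x\<close> is spanned by \<open>x\<close>, the vectors \<open>z\<close> and \<open>W\<close>. If \<open>u\<close> is annihilated by \<open>x\<close>, it
has no component along \<open>1\<close> or any \<open>y\<^sub>i\<close>. Multiplying \<open>u\<close> with a vector \<open>z\<close> returns the component of
\<open>u\<close> along \<open>z\<close> as the coefficient of \<open>w\<^sub>1\<close>, so these components vanish as well. What remains is the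
span of \<open>x\<close> and \<open>W\<close>, that is, the ideal generated by \<open>x\<close>.\<close>

lemma x_double_annihilator:
  assumes u: "u \<in> carrier alg"
    and ann: "\<And>b. \<lbrakk>b \<in> carrier alg; b \<otimes>\<^bsub>alg\<^esub> x = \<zero>\<^bsub>alg\<^esub>\<rbrakk> \<Longrightarrow> b \<otimes>\<^bsub>alg\<^esub> u = \<zero>\<^bsub>alg\<^esub>"
  shows "u \<in> PIdl\<^bsub>alg\<^esub> x"
proof -
  have "x \<otimes>\<^bsub>alg\<^esub> x = \<zero>\<^bsub>alg\<^esub>"
    by (rule ext, subst mult_x[OF x_closed]) (auto simp: alg_zero x_def unit_vec_def)
  then have "x \<otimes>\<^bsub>alg\<^esub> u = \<zero>\<^bsub>alg\<^esub>" using ann x_closed by blast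
  then have ux: "(u \<otimes>\<^bsub>alg\<^esub> x) k = \<zero>" for k
    using alg_m_comm[OF u x_closed] by (simp add: alg_zero)
  have u0: "u 0 = \<zero>" using ux[of 1] by (simp add: mult_x[OF u])
  have uy: "u i = \<zero>" if i: "2 \<le> i" "i \<le> a + 1" for i
  proof -
    obtain j where "i = Suc j" "1 \<le> j" "j \<le> a" using i by (cases i) auto
    then show ?thesis using ux[of "e + j"] a_less by (simp add: mult_x[OF u])
  qed
  have uz: "u i = \<zero>" if i: "a + 2 \<le> i" "i \<le> e" for i
  proof -
    let ?z = "unit_vec i"
    have z: "?z \<in> carrier alg" using i by (intro unit_vec_closed) simp
    have "?z \<otimes>\<^bsub>alg\<^esub> x = \<zero>\<^bsub>alg\<^esub>"
      by (rule ext, subst mult_x[OF z]) (use i in \<open>auto simp: alg_zero unit_vec_def\<close>)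
    then have "(?z \<otimes>\<^bsub>alg\<^esub> u) (Suc e) = \<zero>" using ann[OF z] by (simp add: alg_zero)
    moreover have "(\<Oplus>j\<in>{a + 2..e}. ?z j \<otimes> u j) = (\<Oplus>j\<in>{a + 2..e}. if i = j then u j else \<zero>)"
      by (rule finsum_cong') (use coeff_closed[OF u] in \<open>auto simp: unit_vec_def\<close>)
    then have "(\<Oplus>j\<in>{a + 2..e}. ?z j \<otimes> u j) = u i"
      using i coeff_closed[OF u] by (simp add: add.finprod_singleton)
    ultimately show ?thesis
      using i a_pos coeff_closed[OF u] by (simp add: alg_mult form_def) (simp add: unit_vec_def)
  qed
  have "u i = \<zero>" if "i \<notin> insert 1 {e<..e + a}" for i
  proof -
    have "i \<noteq> 1" and "i \<le> e \<or> i > e + a" using that by auto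
    then consider "i = 0" | "2 \<le> i" "i \<le> a + 1" | "a + 2 \<le> i" "i \<le> e" | "i > e + a"
      by linarith
    then show ?thesis using u0 uy uz coeff_outside[OF u] by cases auto
  qed
  then show ?thesis using u unfolding PIdl_x coord_space_def by blast
qed

lemma image_top_support: "(\<lambda>i. Suc (e + i)) ` {..<a} = {e<..e + a}"
proof
  show "{e<..e + a} \<subseteq> (\<lambda>i. Suc (e + i)) ` {..<a}"
  proof
    fix j assume "j \<in> {e<..e + a}"
    then have "j = Suc (e + (j - Suc e))" and "j - Suc e \<in> {..<a}" by auto
    then show "j \<in> (\<lambda>i. Suc (e + i)) ` {..<a}" by (rule image_eqI)
  qed
qed auto

lemma has_length_square_radical: "has_length alg ((regular_module alg)\<lparr>carrier := coord_space {e<..e + a}\<rparr>) a"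
proof -
  let ?s = "\<lambda>i. Suc (e + i)"
  have "composition_chain alg ((regular_module alg)\<lparr>carrier := coord_space ({} \<union> ?s ` {..<a})\<rparr>)
    (\<lambda>i. coord_space ({} \<union> ?s ` {..<i})) a"
    by (rule coord_space_composition_chain) (auto simp: inj_on_def ideal_support_def)
  then show ?thesis
    using has_length_composition_chain by (fastforce simp: image_top_support coord_space_empty)
qed

lemma hilbert_type_alg: "hilbert_type alg e a"
proof -
  have img: "{e<..e + a} \<union> Suc ` {..<e} = {0<..e + a}"
    unfolding image_Suc_lessThan by auto
  let ?M = "(regular_module alg)\<lparr>carrier := coord_space {0<..e + a}\<rparr>"
  let ?D = "\<lambda>i. coord_space ({e<..e + a} \<union> Suc ` {..<i})"
  interpret M: module alg ?M
    by (rule A.module_ideal[OF ideal_coord_space[OF ideal_support_radical]])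
  have "composition_chain alg ((regular_module alg)\<lparr>carrier := ?D e\<rparr>) ?D e"
    by (rule coord_space_composition_chain) (auto simp: ideal_support_def)
  then have "has_length alg (quotient_module ?M (?D 0)) e"
    by (intro M.has_length_quotient_module) (simp_all add: img)
  then show ?thesis
    unfolding hilbert_type_def Let_def radical_alg square_radical using has_length_square_radical by simp
qed

abbreviation M :: "(nat \<Rightarrow> 'a, nat \<Rightarrow> 'a) module" where
  "M \<equiv> (regular_module alg)\<lparr>carrier := PIdl\<^bsub>alg\<^esub> x\<rparr>"

lemma support_M: "ideal_support (insert 1 {e<..e + a})"
  using a_less by (auto simp: ideal_support_def)

lemma module_M: "module alg M"
  unfolding PIdl_x by (rule A.module_ideal[OF ideal_coord_space[OF support_M]])

lemma PIdl_x_subset_radical: "PIdl\<^bsub>alg\<^esub> x \<subseteq> coord_space {0<..e + a}"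
  unfolding PIdl_x by (rule coord_space_mono) (use a_less in auto)

lemma radical_mult_M: "smult_prod M (radical alg) (carrier M) = coord_space {e<..e + a}"
proof
  interpret W: ideal "coord_space {e<..e + a}" alg
    by (rule ideal_coord_space[OF ideal_support_top])
  show "smult_prod M (radical alg) (carrier M) \<subseteq> coord_space {e<..e + a}"
  proof
    fix v assume "v \<in> smult_prod M (radical alg) (carrier M)"
    then show "v \<in> coord_space {e<..e + a}"
    proof induction
      case (prod r u)
      then have "u \<in> coord_space {0<..e + a}" using PIdl_x_subset_radical by auto
      then show ?case using prod mult_radical_radical unfolding radical_alg by simp
    next
      case (sum u v)
      then show ?case by simp
    qed
  qed
  show "coord_space {e<..e + a} \<subseteq> smult_prod M (radical alg) (carrier M)"
  proof
    fix v assume "v \<in> coord_space {e<..e + a}"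
    then obtain r where "r \<in> radical alg" "v = r \<odot>\<^bsub>M\<^esub> x"
      using top_eq_radical_mult_x unfolding radical_alg by auto
    moreover have "x \<in> carrier M" using A.cgenideal_self[OF x_closed] by simp
    ultimately show "v \<in> smult_prod M (radical alg) (carrier M)"
      using smult_prod.prod by metis
  qed
qed

lemma radical_mult_square: "smult_prod M (radical alg) (coord_space {e<..e + a}) = {\<zero>\<^bsub>M\<^esub>}"
proof -
  have "v = \<zero>\<^bsub>alg\<^esub>" if "v \<in> smult_prod M (radical alg) (coord_space {e<..e + a})" for v
    using that
  proof induction
    case (prod r w)
    then have "r \<in> carrier alg" "w \<in> carrier alg"
      using coord_space_subset unfolding radical_alg by blast+
    then show ?case using prod mult_square_radical[of w r] A.m_comm[of r w] unfolding radical_alg by simp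
  qed simp
  moreover have "\<zero>\<^bsub>alg\<^esub> \<in> coord_space S" for S
    by (simp add: coord_space_def alg_zero)
  then have "\<zero>\<^bsub>alg\<^esub> \<odot>\<^bsub>M\<^esub> \<zero>\<^bsub>alg\<^esub> \<in> smult_prod M (radical alg) (coord_space {e<..e + a})"
    unfolding radical_alg by (intro smult_prod.prod)
  then have "\<zero>\<^bsub>alg\<^esub> \<in> smult_prod M (radical alg) (coord_space {e<..e + a})"
    by simp
  ultimately have "smult_prod M (radical alg) (coord_space {e<..e + a}) = {\<zero>\<^bsub>alg\<^esub>}"
    by blast
  then show ?thesis by simp
qed

lemma loewy_length_M: "loewy_length alg M 2"
proof -
  have ne: "S \<noteq> {\<zero>\<^bsub>alg\<^esub>}" if "unit_vec i \<in> S" for i and S :: "(nat \<Rightarrow> 'a) set"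
  proof
    assume "S = {\<zero>\<^bsub>alg\<^esub>}"
    then have "unit_vec i i = \<zero>\<^bsub>alg\<^esub> i" using that by simp
    then show False by (simp add: unit_vec_def alg_zero)
  qed
  have "unit_vec 1 \<in> carrier M" using A.cgenideal_self[OF x_closed] by (simp add: x_def)
  moreover have "unit_vec (Suc e) \<in> coord_space {e<..e + a}"
    by (rule unit_vec_coord_space) (use a_pos in auto)
  ultimately show ?thesis
    using ne radical_mult_M radical_mult_square
    by (simp add: loewy_length_def numeral_2_eq_2 less_Suc_eq)
qed

lemma dimension_vector_M: "dimension_vector alg M 1 a"
proof -
  define D where "D = (\<lambda>i. coord_space ({e<..e + a} \<union> (\<lambda>_. 1) ` {..<i::nat}))"
  have D: "D 0 = coord_space {e<..e + a}" "D 1 = carrier M"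
    by (simp_all add: D_def PIdl_x lessThan_Suc)
  have "composition_chain alg ((regular_module alg)\<lparr>carrier := D 1\<rparr>) D 1"
    unfolding D_def
    by (rule coord_space_composition_chain) (use a_less in \<open>auto simp: ideal_support_def inj_on_def\<close>)
  then have chain: "composition_chain alg M D 1" using D(2) by simp
  interpret M: module alg M by (rule module_M)
  show ?thesis
    using M.has_length_quotient_module[OF chain D(2)] has_length_square_radical
    unfolding dimension_vector_def Let_def radical_mult_M D(1) by simp
qed

text \<open>The series first fills \<open>W\<close> and then adds \<open>x\<close>, at step \<open>a\<close>.\<close>

lemma finite_length_M: "finite_length_module alg M"
proof -
  define s where "s = (\<lambda>i. if i < a then Suc (e + i) else 1)"
  have img: "s ` {..<Suc a} = insert 1 {e<..e + a}"
  proof -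
    have "s ` {..<a} = {e<..e + a}"
      unfolding image_top_support[symmetric] by (rule image_cong) (auto simp: s_def)
    moreover have "s a = 1" by (simp add: s_def)
    ultimately show ?thesis by (simp only: lessThan_Suc image_insert)
  qed
  have support: "ideal_support ({} \<union> s ` {..<i})" if "i \<le> Suc a" for i
  proof (cases "i \<le> a")
    case True
    then show ?thesis by (auto simp: ideal_support_def s_def)
  next
    case False
    then have "i = Suc a" using that by simp
    then show ?thesis using support_M img by simp
  qed
  have "composition_chain alg ((regular_module alg)\<lparr>carrier := coord_space ({} \<union> s ` {..<Suc a})\<rparr>)
    (\<lambda>i. coord_space ({} \<union> s ` {..<i})) (Suc a)"
    by (rule coord_space_composition_chain[OF _ _ support])
      (use a_less in \<open>auto simp: inj_on_def s_def split: if_splits\<close>)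
  then have "has_length alg M (Suc a)"
    unfolding img PIdl_x Un_empty_left
    by (rule has_length_composition_chain) (simp_all add: img coord_space_empty)
  then show ?thesis
    unfolding finite_length_module_def using module.left_module[OF module_M] by blast
qed

end

theorem proposition15p1:
  fixes K :: "('k, 'm) ring_scheme" and a e :: nat
  assumes "field K" and "1 \<le> a" and "a \<le> e - 1"
  shows "\<exists>(A :: ('k, nat \<Rightarrow> 'k) module) (M :: (nat \<Rightarrow> 'k, nat \<Rightarrow> 'k) module).
    short_local_algebra K A \<and> cring A \<and> hilbert_type A e a \<and>
    finite_length_module A M \<and> reflexive_module A M \<and>
    loewy_length A M 2 \<and> dimension_vector A M 1 a"
proof -
  interpret reflexive_example K e a
    by (intro reflexive_example.intro reflexive_example_axioms.intro) (use assms in auto)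
  show ?thesis
    using alg_short_local_algebra alg_cring hilbert_type_alg finite_length_M loewy_length_M
      dimension_vector_M A.reflexive_principal_ideal[OF x_closed x_double_annihilator]
    by blast
qed

end
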